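(* Let $p_o,p_v\in(0,1)$ and let $\mathcal{L}\neq\delta_0$ be a law on $\mathbb{R}$. Then $\bar M_c(p_o,p_v;\mathcal{L})<\infty$ if and only if $\mathcal{L}$ has bounded support and no atoms different from zero.
   Context: **Lattice and paths.** The square lattice is the graph $(\mathbb{Z}^2,E_2)$, where $E_2$ is the set of unordered pairs $\{(x_1,y_1),(x_2,y_2)\}$ of points of $\mathbb{Z}^2$ with $|x_1-x_2|+|y_1-y_2|=1$. An edge is horizontal if $|x_1-x_2|=1$ and vertical if $|y_1-y_2|=1$. A finite path from $u$ to $v$ is a finite sequence $\gamma=(u=v_0,e_1,v_1,\ldots,e_n,v_n=v)$ with $v_k\in\mathbb{Z}^2$ and $e_k=\{v_{k-1},v_k\}\in E_2$ for $k=1,\ldots,n$. Its length is $|\gamma|=n$. Paths are not required to be self-avoiding. $\Gamma_{u,v}$ denotes the set of all finite paths from $u$ to $v$. **Random environment.** $\mathbf{X}=(X_e:e\in E_2)$ and $\mathbf{Y}=(Y_e:e\in E_2)$ are two families of independent random variables, $\mathbf{X}$ and $\mathbf{Y}$ being independent of each other. Each $X_e$ is real-valued with common law $\mathcal{L}\neq\delta_0$. Each $Y_e$ takes values in $\{-1,+1\}$, with $\mathbb{P}(Y_e=1)=p_o$ if $e$ is horizontal and $\mathbb{P}(Y_e=1)=p_v$ if $e$ is vertical. **Partial sums.** For a path $\gamma=(v_0,e_1,v_1,\ldots)$ with $v_k=(x_k,y_k)$, set $Z_{(v_{k-1},v_k)}=(x_k-x_{k-1}+y_k-y_{k-1})\,Y_{e_k}$,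 so that $Y_{e_k}$ is multiplied by $+1$ if $e_k$ is crossed rightward or upward and by $-1$ if it is crossed leftward or downward. Set $S_N(\gamma)=\sum_{k=1}^N Z_{(v_{k-1},v_k)}X_{e_k}$ for $N\le|\gamma|$. **The constant $\bar M_c$.** Let $\bar\Sigma=\sup_{u,v\in\mathbb{Z}^2}\inf_{\gamma\in\Gamma_{u,v}}\sup_{N\le|\gamma|}|S_N(\gamma)|\in[0,+\infty]$. By ergodicity with respect to the translations of $\mathbb{Z}^2$, $\bar\Sigma$ is almost surely equal to a constant, and $\bar M_c=\bar M_c(p_o,p_v;\mathcal{L})\in[0,+\infty]$ denotes this almost sure value. An atom of $\mathcal{L}$ is a point $x\in\mathbb{R}$ with $\mathcal{L}(\{x\})>0$. *)

theory Defs
  imports "HOL-Probability.Probability"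
begin

type_synonym vertex = "int \<times> int"
type_synonym edge = "vertex set"

definition E2 :: "edge set" where
  "E2 = {{(x1, y1), (x2, y2)} | x1 y1 x2 y2. \<bar>x1 - x2\<bar> + \<bar>y1 - y2\<bar> = 1}"

definition horizontal :: "edge \<Rightarrow> bool" where
  "horizontal e \<longleftrightarrow> e \<in> E2 \<and> (\<exists>x1 y1 x2 y2. e = {(x1, y1), (x2, y2)} \<and> \<bar>x1 - x2\<bar> = 1)"

definition vertical :: "edge \<Rightarrow> bool" where
  "vertical e \<longleftrightarrow> e \<in> E2 \<and> (\<exists>x1 y1 x2 y2. e = {(x1, y1), (x2, y2)} \<and> \<bar>y1 - y2\<bar> = 1)"

text \<open>A path is represented by the nonempty list of its vertices \<open>v\<^sub>0, \<dots>, v\<^sub>n\<close>; its edges are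
  determined by them, as \<open>e\<^sub>k = {v\<^sub>k\<^sub>-\<^sub>1, v\<^sub>k}\<close>. The trivial path with one vertex is allowed,
  and vertices may be repeated.\<close>

definition lattice_paths :: "vertex \<Rightarrow> vertex \<Rightarrow> vertex list set" where
  "lattice_paths u v =
     {\<gamma>. \<gamma> \<noteq> [] \<and> hd \<gamma> = u \<and> last \<gamma> = v \<and> successively (\<lambda>a b. {a, b} \<in> E2) \<gamma>}"

definition path_len :: "vertex list \<Rightarrow> nat" where
  "path_len \<gamma> = length \<gamma> - 1"

text \<open>Below, \<open>x\<close> and \<open>y\<close> are realizations of the two random fields.\<close>

definition step_sign :: "(edge \<Rightarrow> real) \<Rightarrow> vertex \<Rightarrow> vertex \<Rightarrow> real" where
  "step_sign y a b = of_int (fst b - fst a + snd b - snd a) * y {a, b}"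

definition path_sum ::
    "(edge \<Rightarrow> real) \<Rightarrow> (edge \<Rightarrow> real) \<Rightarrow> vertex list \<Rightarrow> nat \<Rightarrow> real" where
  "path_sum x y \<gamma> N =
     (\<Sum>k=1..N. step_sign y (\<gamma> ! (k - 1)) (\<gamma> ! k) * x {\<gamma> ! (k - 1), \<gamma> ! k})"

definition Sigma_bar :: "(edge \<Rightarrow> real) \<Rightarrow> (edge \<Rightarrow> real) \<Rightarrow> ennreal" where
  "Sigma_bar x y =
     (SUP u. SUP v. INF \<gamma>\<in>lattice_paths u v. SUP N\<in>{..path_len \<gamma>}. ennreal \<bar>path_sum x y \<gamma> N\<bar>)"

locale random_environment = prob_space M
  for M :: "'a measure" +
  fixes X Y :: "edge \<Rightarrow> 'a \<Rightarrow> real"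
    and p_o p_v :: real
    and L :: "real measure"
  assumes indep_X: "indep_vars (\<lambda>_. borel) X E2"
    and indep_Y: "indep_vars (\<lambda>_. borel) Y E2"
    and indep_X_Y: "indep_var (\<Pi>\<^sub>M e\<in>E2. borel) (\<lambda>\<omega>. \<lambda>e\<in>E2. X e \<omega>)
                              (\<Pi>\<^sub>M e\<in>E2. borel) (\<lambda>\<omega>. \<lambda>e\<in>E2. Y e \<omega>)"
    and law_X: "\<And>e. e \<in> E2 \<Longrightarrow> distr M borel (X e) = L"
    and Y_values: "\<And>e \<omega>. e \<in> E2 \<Longrightarrow> \<omega> \<in> space M \<Longrightarrow> Y e \<omega> \<in> {-1, 1}"
    and Y_horizontal: "\<And>e. horizontal e \<Longrightarrow> prob {\<omega> \<in> space M. Y e \<omega> = 1} = p_o"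
    and Y_vertical: "\<And>e. vertical e \<Longrightarrow> prob {\<omega> \<in> space M. Y e \<omega> = 1} = p_v"

text \<open>The almost sure value of \<^const>\<open>Sigma_bar\<close>. At most one \<open>c\<close> qualifies; that one exists is
  the ergodicity statement and is not built into the definition.\<close>

definition M_c_bar :: "'a measure \<Rightarrow> (edge \<Rightarrow> 'a \<Rightarrow> real) \<Rightarrow> (edge \<Rightarrow> 'a \<Rightarrow> real) \<Rightarrow> ennreal" where
  "M_c_bar M X Y = (THE c. AE \<omega> in M. Sigma_bar (\<lambda>e. X e \<omega>) (\<lambda>e. Y e \<omega>) = c)"

definition law_support :: "real measure \<Rightarrow> real set" where
  "law_support L = {x. \<forall>U. open U \<longrightarrow> x \<in> U \<longrightarrow> 0 < measure L U}"

definition atom :: "real measure \<Rightarrow> real \<Rightarrow> bool" where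
  "atom L x \<longleftrightarrow> 0 < measure L {x}"

end

theory Submission imports Defs begin

text \<open>The partial sums depend on the environment only through the signed weights
\<open>w e = Y e * X e\<close>. Crossing an edge backwards undoes the contribution of crossing it
forwards, so a path carries a height that is the integral of an antisymmetric
flow, and the question is whether any two vertices are joined by a path along which this height
stays below one common bound. The weights are independent, and their law \<open>q L + (1 - q) L'\<close>,
with \<open>L'\<close> the reflection of \<open>L\<close>, depends only on the orientation of the edge.

\<^bold>\<open>Bounded support, no atom except zero.\<close> Let \<open>K\<close> bound the weights. For a plaquette
with a nonzero edge, the total flow around it is almost surely nonzero: the weight of that edge,
given to be nonzero, has no atom and is independent of the other three. Hence a path that has
just crossed a nonzero edge can circle an adjacent plaquette, in the appropriate
direction and as often as necessary, until its height is at most \<open>2 * K\<close> again; crossing an edge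
of weight zero costs nothing. In this way every vertex is reached from every other one with
heights at most \<open>7 * K\<close> (\<open>Sigma_bar_le\<close>, \<open>AE_circulation_neq_0\<close>).

\<^bold>\<open>Otherwise.\<close> If the support is unbounded, then with positive probability the four edges at the
origin are so heavy that the first step of any path from the origin to another vertex is
already too large
(\<open>blocked_large_edges\<close>). If \<open>x\<close> is a nonzero atom, then, since both signs of \<open>Y\<close> have positive
probability, with positive probability the weights in a ball of radius \<open>n\<close> are the gradient of
\<open>x\<close> times the \<open>\<ell>\<^sup>1\<close>-norm, so that every path leaving the ball
reaches an absolute height of \<open>n * \<bar>x\<bar>\<close>
(\<open>blocked_outward\<close>).

\<^bold>\<open>From positive probability to probability one.\<close> That some pair of vertices cannot be joined below
height \<open>t\<close> is a translation invariant event, hence of probability zero or one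
(\<open>zero_one_law_reindexing_invariant\<close>). Therefore patterns of positive probability suffice in the
second case. Letting \<open>t\<close> range over the rationals shows moreover that \<^const>\<open>Sigma_bar\<close> is almost surely
constant, so that \<^const>\<open>M_c_bar\<close> really is this constant (\<open>AE_Sigma_bar_eq_M_c_bar\<close>).\<close>

section \<open>Heights along lattice paths\<close>

definition flow :: "(edge \<Rightarrow> real) \<Rightarrow> vertex \<Rightarrow> vertex \<Rightarrow> real" where
  "flow w a b = of_int (fst b - fst a + snd b - snd a) * w {a, b}"

definition height :: "(edge \<Rightarrow> real) \<Rightarrow> vertex list \<Rightarrow> nat \<Rightarrow> real" where
  "height w \<gamma> N = (\<Sum>k=1..N. flow w (\<gamma> ! (k - 1)) (\<gamma> ! k))"

lemma path_sum_eq_height: "path_sum x y = height (\<lambda>e. y e * x e)"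
  by (simp add: fun_eq_iff path_sum_def height_def flow_def step_sign_def mult.assoc)

lemma flow_reverse: "flow w b a = - flow w a b"
  by (simp add: flow_def insert_commute left_diff_distrib distrib_right)

lemma edge_iff: "{a, b} \<in> E2 \<longleftrightarrow> \<bar>fst a - fst b\<bar> + \<bar>snd a - snd b\<bar> = 1"
proof
  assume "{a, b} \<in> E2"
  then obtain x1 y1 x2 y2 where "{a, b} = {(x1, y1), (x2, y2)}" "\<bar>x1 - x2\<bar> + \<bar>y1 - y2\<bar> = 1"
    unfolding E2_def by blast
  then show "\<bar>fst a - fst b\<bar> + \<bar>snd a - snd b\<bar> = 1"
    by (auto simp: doubleton_eq_iff abs_minus_commute)
next
  assume "\<bar>fst a - fst b\<bar> + \<bar>snd a - snd b\<bar> = 1"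
  then show "{a, b} \<in> E2"
    unfolding E2_def mem_Collect_eq by (metis prod.collapse)
qed

lemma E2_cases:
  assumes "e \<in> E2"
  obtains a b where "e = {a, b}" "{a, b} \<in> E2"
  using assms unfolding E2_def by blast

lemma countable_E2: "countable E2"
proof -
  have "E2 \<subseteq> (\<lambda>(a, b). {a, b}) ` UNIV"
  proof
    fix e assume "e \<in> E2"
    then obtain a b where "e = {a, b}" by (rule E2_cases)
    then have "e = (\<lambda>(a, b). {a, b}) (a, b)" by simp
    then show "e \<in> range (\<lambda>(a, b). {a, b})" by blast
  qed
  then show ?thesis
    by (rule countable_subset) (intro countable_image countableI_type)
qed

lemma flow_sign:
  assumes "{a, b} \<in> E2"
  shows "\<bar>fst b - fst a + snd b - snd a\<bar> = 1"
  using assms unfolding edge_iff by linarith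

lemma abs_flow:
  assumes "{a, b} \<in> E2"
  shows "\<bar>flow w a b\<bar> = \<bar>w {a, b}\<bar>"
proof -
  show ?thesis
    using flow_sign[OF assms] unfolding flow_def abs_mult by (simp only: flip: of_int_abs)
qed

lemma height_0 [simp]: "height w \<gamma> 0 = 0"
  by (simp add: height_def)

lemma height_Suc [simp]: "height w \<gamma> (Suc N) = height w \<gamma> N + flow w (\<gamma> ! N) (\<gamma> ! Suc N)"
  by (simp add: height_def)

lemma lattice_path_edge:
  assumes "\<gamma> \<in> lattice_paths u v" "k < path_len \<gamma>"
  shows "{\<gamma> ! k, \<gamma> ! Suc k} \<in> E2"
  using assms unfolding lattice_paths_def path_len_def successively_conv_nth by simp

lemma lattice_path_ends:
  assumes "\<gamma> \<in> lattice_paths u v"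
  shows "\<gamma> ! 0 = u" "\<gamma> ! path_len \<gamma> = v"
  using assms by (auto simp: lattice_paths_def path_len_def hd_conv_nth last_conv_nth)

text \<open>The negation asks for a path from \<open>u\<close> to \<open>v\<close> with all heights strictly below \<open>t\<close>. Up to the
choice between strict and weak inequality these are the superlevel events of
\<^const>\<open>Sigma_bar\<close>, but each of them is built from the paths by countable unions and intersections
alone, without suprema.\<close>
definition blocked :: "(edge \<Rightarrow> real) \<Rightarrow> real \<Rightarrow> vertex \<Rightarrow> vertex \<Rightarrow> bool" where
  "blocked w t u v \<longleftrightarrow> (\<forall>\<gamma>\<in>lattice_paths u v. \<exists>N\<le>path_len \<gamma>. t \<le> \<bar>height w \<gamma> N\<bar>)"

lemma blocked_le_Sigma_bar:
  assumes "blocked (\<lambda>e. y e * x e) t u v"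
  shows "ennreal t \<le> Sigma_bar x y"
proof -
  have "ennreal t \<le> (SUP N\<in>{..path_len \<gamma>}. ennreal \<bar>path_sum x y \<gamma> N\<bar>)"
    if "\<gamma> \<in> lattice_paths u v" for \<gamma>
  proof -
    have "\<exists>N\<le>path_len \<gamma>. t \<le> \<bar>path_sum x y \<gamma> N\<bar>"
      using assms that unfolding blocked_def path_sum_eq_height by (rule bspec)
    then obtain N where N: "N \<le> path_len \<gamma>" "t \<le> \<bar>path_sum x y \<gamma> N\<bar>"
      by (elim exE conjE)
    show ?thesis
      by (rule SUP_upper2[of N]) (use N in \<open>auto intro: ennreal_leI\<close>)
  qed
  show ?thesis
    unfolding Sigma_bar_def
    by (rule SUP_upper2[where i = u], simp, rule SUP_upper2[where i = v], simp, rule INF_greatest, fact)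
qed

lemma less_Sigma_bar_blocked:
  assumes "ennreal t < Sigma_bar x y" 
  shows "\<exists>u v. blocked (\<lambda>e. y e * x e) t u v"
proof -
  from assms obtain u v where
    uv: "ennreal t < (INF \<gamma>\<in>lattice_paths u v. SUP N\<in>{..path_len \<gamma>}. ennreal \<bar>path_sum x y \<gamma> N\<bar>)"
    unfolding Sigma_bar_def less_SUP_iff by blast
  have "blocked (\<lambda>e. y e * x e) t u v"
    unfolding blocked_def
  proof
    fix \<gamma> assume "\<gamma> \<in> lattice_paths u v"
    then have "ennreal t < (SUP N\<in>{..path_len \<gamma>}. ennreal \<bar>path_sum x y \<gamma> N\<bar>)"
      using uv by (rule less_INF_D[rotated])
    then obtain N where "N \<le> path_len \<gamma>" "ennreal t < ennreal \<bar>path_sum x y \<gamma> N\<bar>"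
      unfolding less_SUP_iff by auto
    then show "\<exists>N\<le>path_len \<gamma>. t \<le> \<bar>height (\<lambda>e. y e * x e) \<gamma> N\<bar>"
      unfolding path_sum_eq_height by (intro exI[of _ N]) (metis ennreal_leI less_le_not_le linear)
  qed
  then show ?thesis by blast
qed

lemma height_cong:
  assumes "\<And>e. e \<in> E2 \<Longrightarrow> w e = w' e" "\<gamma> \<in> lattice_paths u v" "N \<le> path_len \<gamma>"
  shows "height w \<gamma> N = height w' \<gamma> N"
  using assms(3)
  by (induction N) (auto simp: flow_def assms(1) lattice_path_edge[OF assms(2)])

lemma blocked_cong:
  assumes "\<And>e. e \<in> E2 \<Longrightarrow> w e = w' e"
  shows "blocked w t u v \<longleftrightarrow> blocked w' t u v"
proof -
  have "height w \<gamma> N = height w' \<gamma> N"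
    if "\<gamma> \<in> lattice_paths u v" "N \<le> path_len \<gamma>" for \<gamma> N
    using height_cong assms that by blast
  then show ?thesis
    unfolding blocked_def by (auto cong: conj_cong)
qed

section \<open>Invariance under horizontal translations\<close>

definition translate :: "int \<Rightarrow> vertex \<Rightarrow> vertex" where
  "translate k a = (fst a + k, snd a)"

lemma translate_translate [simp]: "translate k (translate l a) = translate (k + l) a"
  and translate_0 [simp]: "translate 0 a = a"
  by (simp_all add: translate_def)

lemma translate_E2 [simp]: "{translate k a, translate k b} \<in> E2 \<longleftrightarrow> {a, b} \<in> E2"
  by (simp add: edge_iff translate_def)

lemma flow_translate: "flow (\<lambda>e. w (translate k ` e)) a b = flow w (translate k a) (translate k b)"
  by (simp add: flow_def translate_def)

lemma translate_lattice_paths: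
  assumes "\<gamma> \<in> lattice_paths u v"
  shows "map (translate k) \<gamma> \<in> lattice_paths (translate k u) (translate k v)"
  using assms by (auto simp: lattice_paths_def hd_map last_map successively_map)

lemma blocked_translate:
  assumes "blocked (\<lambda>e. w (translate k ` e)) t u v"
  shows "blocked w t (translate k u) (translate k v)"
  unfolding blocked_def
proof
  fix \<gamma> assume \<gamma>: "\<gamma> \<in> lattice_paths (translate k u) (translate k v)"
  define \<delta> where "\<delta> = map (translate (- k)) \<gamma>"
  have \<delta>: "\<delta> \<in> lattice_paths u v"
    using translate_lattice_paths[OF \<gamma>, of "- k"] by (simp add: \<delta>_def)
  have len: "path_len \<delta> = path_len \<gamma>"
    by (simp add: \<delta>_def path_len_def)
  have "height (\<lambda>e. w (translate k ` e)) \<delta> N = height w \<gamma> N" if "N \<le> path_len \<gamma>" for N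
    using that by (induction N) (auto simp: flow_translate \<delta>_def path_len_def)
  then show "\<exists>N\<le>path_len \<gamma>. t \<le> \<bar>height w \<gamma> N\<bar>"
    using assms \<delta> len unfolding blocked_def by fastforce
qed

lemma blocked_translate_iff:
  "(\<exists>u v. blocked (\<lambda>e. w (translate k ` e)) t u v) \<longleftrightarrow> (\<exists>u v. blocked w t u v)"
proof
  assume "\<exists>u v. blocked w t u v"
  moreover have "w = (\<lambda>e. (\<lambda>e. w (translate k ` e)) (translate (- k) ` e))"
    by (simp add: image_image)
  ultimately show "\<exists>u v. blocked (\<lambda>e. w (translate k ` e)) t u v"
    using blocked_translate[of "\<lambda>e. w (translate k ` e)" "- k"] by metis
qed (blast intro: blocked_translate)

section \<open>Controlling the height by circling plaquettes\<close>

text \<open>\<open>reach w C u v s\<close> holds if some path from \<open>u\<close> to \<open>v\<close> ends at height \<open>s\<close> and has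
absolute height at most \<open>C\<close> after each of its steps. Recording only the endpoint and its height makes it possible to extend
paths without handling vertex lists.\<close>
inductive reach :: "(edge \<Rightarrow> real) \<Rightarrow> real \<Rightarrow> vertex \<Rightarrow> vertex \<Rightarrow> real \<Rightarrow> bool"
  for w C u where
  start: "reach w C u u 0"
| step: "reach w C u b (s + flow w a b)"
    if "reach w C u a s" "{a, b} \<in> E2" "\<bar>s + flow w a b\<bar> \<le> C"

lemma height_snoc:
  assumes "N \<le> path_len \<gamma>" "\<gamma> \<noteq> []"
  shows "height w (\<gamma> @ [b]) N = height w \<gamma> N"
  using assms by (induction N) (auto simp: nth_append path_len_def)

lemma reach_path:
  assumes "reach w C u v s" "0 \<le> C"
  shows "\<exists>\<gamma>\<in>lattice_paths u v. height w \<gamma> (path_len \<gamma>) = s \<and> (\<forall>N\<le>path_len \<gamma>. \<bar>height w \<gamma> N\<bar> \<le> C)"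
  using assms
proof (induction rule: reach.induct)
  case start
  then show ?case
    by (intro bexI[of _ "[u]"]) (auto simp: lattice_paths_def path_len_def)
next
  case (step a s b)
  then obtain \<gamma> where \<gamma>: "\<gamma> \<in> lattice_paths u a" "height w \<gamma> (path_len \<gamma>) = s"
    "\<forall>N\<le>path_len \<gamma>. \<bar>height w \<gamma> N\<bar> \<le> C" by blast
  have ne: "\<gamma> \<noteq> []" and len: "path_len (\<gamma> @ [b]) = Suc (path_len \<gamma>)"
    using \<gamma>(1) by (auto simp: lattice_paths_def path_len_def)
  have "(\<gamma> @ [b]) ! path_len \<gamma> = a" "(\<gamma> @ [b]) ! Suc (path_len \<gamma>) = b"
    using ne lattice_path_ends[OF \<gamma>(1)] by (auto simp: nth_append path_len_def)
  then have end_height: "height w (\<gamma> @ [b]) (Suc (path_len \<gamma>)) = s + flow w a b"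
    using \<gamma>(2) height_snoc[OF order_refl ne] by simp
  have "\<gamma> @ [b] \<in> lattice_paths u b"
    using \<gamma>(1) step.hyps by (auto simp: lattice_paths_def successively_append_iff)
  moreover have "\<forall>N\<le>Suc (path_len \<gamma>). \<bar>height w (\<gamma> @ [b]) N\<bar> \<le> C"
    using end_height step.hyps \<gamma>(3) height_snoc[OF _ ne] by (metis le_Suc_eq)
  ultimately show ?case
    using end_height len by metis
qed

lemma lattice_connected:
  assumes "P u" "\<And>a b. P a \<Longrightarrow> {a, b} \<in> E2 \<Longrightarrow> P b"
  shows "P (v :: vertex)"
proof -
  have x: "P (x, snd u)" for x
  proof (induction x rule: int_induct[where k = "fst u"])
    case base
    then show ?case using assms(1) by simp
  qed (auto intro: assms(2) simp: edge_iff)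
  have "P (fst v, y)" for y
  proof (induction y rule: int_induct[where k = "snd u"])
    case base
    then show ?case using x by simp
  qed (auto intro: assms(2) simp: edge_iff)
  then show ?thesis by (metis prod.collapse)
qed

text \<open>The translate of \<open>p\<close> by the vector \<open>b - a\<close> turned counterclockwise by a right angle. If \<open>a\<close> and \<open>b\<close> are
adjacent, then \<open>a\<close>, \<open>b\<close>, \<open>left a b b\<close>, \<open>left a b a\<close> are the corners, in cyclic order, of the plaquette
to the left of the step from \<open>a\<close> to \<open>b\<close>.\<close>
definition left :: "vertex \<Rightarrow> vertex \<Rightarrow> vertex \<Rightarrow> vertex" where
  "left a b p = (fst p - (snd b - snd a), snd p + (fst b - fst a))"

definition circulation :: "(edge \<Rightarrow> real) \<Rightarrow> vertex \<Rightarrow> vertex \<Rightarrow> real" where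
  "circulation w a b =
     flow w a b + flow w b (left a b b) + flow w (left a b b) (left a b a) + flow w (left a b a) a"

lemma plaquette_edges:
  assumes "{a, b} \<in> E2"
  shows "{b, left a b b} \<in> E2" "{left a b b, left a b a} \<in> E2" "{left a b a, a} \<in> E2"
  using assms by (auto simp: edge_iff left_def)

text \<open>Circling the plaquette from \<open>b\<close> in either direction changes the height by the circulation with the
corresponding sign. The bound \<open>7 * K\<close> leaves room for four edges of weight at most \<open>K\<close> on top of a
height of at most \<open>3 * K\<close>.\<close>
lemma reach_around_plaquette:
  assumes bound: "\<And>e. e \<in> E2 \<Longrightarrow> \<bar>w e\<bar> \<le> K"
    and e: "{a, b} \<in> E2" and r: "reach w (7 * K) u b s" and s: "\<bar>s\<bar> \<le> 3 * K"
  shows "reach w (7 * K) u b (s + circulation w a b)"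
    and "reach w (7 * K) u b (s - circulation w a b)"
proof -
  note E = e plaquette_edges[OF e]
  define c d where "c = left a b b" and "d = left a b a"
  note E = E[folded c_def d_def]
  have E': "{b, a} \<in> E2" "{a, d} \<in> E2" "{d, c} \<in> E2" "{c, b} \<in> E2"
    using E by (simp_all add: insert_commute)
  have f: "\<bar>flow w a b\<bar> \<le> K" "\<bar>flow w b c\<bar> \<le> K" "\<bar>flow w c d\<bar> \<le> K" "\<bar>flow w d a\<bar> \<le> K"
    using E bound by (auto simp: abs_flow)
  have f': "\<bar>flow w b a\<bar> \<le> K" "\<bar>flow w a d\<bar> \<le> K" "\<bar>flow w d c\<bar> \<le> K" "\<bar>flow w c b\<bar> \<le> K"
    using E' bound by (auto simp: abs_flow)
  have "reach w (7 * K) u c (s + flow w b c)"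
    by (rule step[OF r E(2)]) (use f s in linarith)
  then have "reach w (7 * K) u d (s + flow w b c + flow w c d)"
    by (rule step[OF _ E(3)]) (use f s in linarith)
  then have "reach w (7 * K) u a (s + flow w b c + flow w c d + flow w d a)"
    by (rule step[OF _ E(4)]) (use f s in linarith)
  then have "reach w (7 * K) u b (s + flow w b c + flow w c d + flow w d a + flow w a b)"
    by (rule step[OF _ E(1)]) (use f s in linarith)
  then show "reach w (7 * K) u b (s + circulation w a b)"
    by (simp add: circulation_def c_def d_def add_ac)
  have "reach w (7 * K) u a (s + flow w b a)"
    by (rule step[OF r E'(1)]) (use f' s in linarith)
  then have "reach w (7 * K) u d (s + flow w b a + flow w a d)"
    by (rule step[OF _ E'(2)]) (use f' s in linarith)
  then have "reach w (7 * K) u c (s + flow w b a + flow w a d + flow w d c)"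
    by (rule step[OF _ E'(3)]) (use f' s in linarith)
  then have "reach w (7 * K) u b (s + flow w b a + flow w a d + flow w d c + flow w c b)"
    by (rule step[OF _ E'(4)]) (use f' s in linarith)
  moreover have "s + flow w b a + flow w a d + flow w d c + flow w c b = s - circulation w a b"
    by (simp add: circulation_def c_def d_def flow_reverse[of w b a] flow_reverse[of w a "left a b a"]
        flow_reverse[of w "left a b a" "left a b b"] flow_reverse[of w "left a b b" b])
  ultimately show "reach w (7 * K) u b (s - circulation w a b)"
    by simp
qed

text \<open>Each turn around the plaquette, in the direction opposite to the sign of the height, replaces the
absolute height by its distance to \<open>\<kappa>\<close>, the absolute value of the circulation. Since \<open>\<kappa> \<le> 4 * K\<close>,
as long as the absolute height exceeds \<open>2 * K\<close> a turn either lowers it by \<open>\<kappa>\<close> or overshoots zero by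
less than \<open>2 * K\<close>; so after finitely many turns it is at most \<open>2 * K\<close>.\<close>
lemma reach_small_height:
  assumes bound: "\<And>e. e \<in> E2 \<Longrightarrow> \<bar>w e\<bar> \<le> K"
    and e: "{a, b} \<in> E2" and r: "reach w (7 * K) u b s" and s: "\<bar>s\<bar> \<le> 3 * K"
    and \<kappa>: "circulation w a b \<noteq> 0"
  shows "\<exists>s'. \<bar>s'\<bar> \<le> 2 * K \<and> reach w (7 * K) u b s'"
proof -
  define \<kappa> where "\<kappa> = \<bar>circulation w a b\<bar>"
  have \<kappa>_pos: "0 < \<kappa>"
    using assms(5) by (simp add: \<kappa>_def)
  have \<kappa>_le: "\<kappa> \<le> 4 * K"
    using bound[OF e] plaquette_edges[OF e, THEN bound]
      abs_flow[of _ _ w, OF e] plaquette_edges[OF e, THEN abs_flow[of _ _ w]]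
    unfolding \<kappa>_def circulation_def by linarith
  have around: "reach w (7 * K) u b (s - sgn s * \<kappa>)"
    if "reach w (7 * K) u b s" "\<bar>s\<bar> \<le> 3 * K" for s
    using that reach_around_plaquette[OF bound e that]
    by (auto simp: \<kappa>_def sgn_real_def abs_if)
  have descend: "\<exists>s'. \<bar>s'\<bar> \<le> 2 * K \<and> reach w (7 * K) u b s'"
    if "reach w (7 * K) u b s" "\<bar>s\<bar> \<le> 3 * K" "\<bar>s\<bar> \<le> 2 * K + real n * \<kappa>" for n s
    using that
  proof (induction n arbitrary: s)
    case (Suc n)
    show ?case
    proof (cases "\<bar>s\<bar> \<le> 2 * K")
      case False
      define s' where "s' = s - sgn s * \<kappa>"
      have "\<bar>s'\<bar> = \<bar>\<bar>s\<bar> - \<kappa>\<bar>"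
        using False \<kappa>_pos \<kappa>_le by (auto simp: s'_def sgn_real_def abs_if)
      moreover have "\<bar>s\<bar> \<le> 2 * K + real n * \<kappa> + \<kappa>" "0 \<le> real n * \<kappa>"
        using Suc.prems(3) \<kappa>_pos by (auto simp: algebra_simps)
      ultimately have "\<bar>s'\<bar> \<le> 3 * K" "\<bar>s'\<bar> \<le> 2 * K + real n * \<kappa>"
        using False \<kappa>_pos \<kappa>_le Suc.prems by linarith+
      then show ?thesis
        using Suc.IH[of s'] around[of s] Suc.prems by (simp add: s'_def)
    qed (use Suc.prems in blast)
  qed auto
  obtain n where "\<bar>s\<bar> < real n * \<kappa>"
    using \<kappa>_pos reals_Archimedean3 by blast
  then have "\<bar>s\<bar> \<le> 2 * K + real n * \<kappa>"
    using bound[OF e] by linarith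
  then show ?thesis
    by (rule descend[OF r s])
qed

text \<open>The heights at which a vertex is left can be kept at most \<open>2 * K\<close>: a step along an edge of weight zero
preserves the height, and a step along any other edge brings it to at most \<open>3 * K\<close> and ends on a
plaquette of nonzero circulation, where it can be lowered again.\<close>
lemma Sigma_bar_le:
  assumes bound: "\<And>e. e \<in> E2 \<Longrightarrow> \<bar>y e * x e\<bar> \<le> K"
    and circ: "\<And>a b. {a, b} \<in> E2 \<Longrightarrow> y {a, b} * x {a, b} \<noteq> 0 \<Longrightarrow>
                 circulation (\<lambda>e. y e * x e) a b \<noteq> 0"
  shows "Sigma_bar x y \<le> ennreal (7 * K)"
proof -
  define w where "w = (\<lambda>e. y e * x e)"
  have w: "\<bar>w e\<bar> \<le> K" if "e \<in> E2" for e
    using bound that by (simp add: w_def)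
  have "{(0, 0), (1, 0)} \<in> E2"
    by (simp add: edge_iff)
  from w[OF this] have K: "0 \<le> K" by linarith
  have "\<exists>s. \<bar>s\<bar> \<le> 2 * K \<and> reach w (7 * K) u v s" for u v
  proof (rule lattice_connected[where u = u])
    show "\<exists>s. \<bar>s\<bar> \<le> 2 * K \<and> reach w (7 * K) u u s"
      using K by (intro exI[of _ 0]) (auto intro: start)
  next
    fix a b
    assume "\<exists>s. \<bar>s\<bar> \<le> 2 * K \<and> reach w (7 * K) u a s" and e: "{a, b} \<in> E2"
    then obtain s where s: "\<bar>s\<bar> \<le> 2 * K" "reach w (7 * K) u a s" by blast
    have f: "\<bar>flow w a b\<bar> = \<bar>w {a, b}\<bar>" "\<bar>w {a, b}\<bar> \<le> K"
      using e by (auto simp: abs_flow w)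
    have r: "reach w (7 * K) u b (s + flow w a b)"
      by (rule step[OF s(2) e]) (use s f K in linarith)
    show "\<exists>s. \<bar>s\<bar> \<le> 2 * K \<and> reach w (7 * K) u b s"
    proof (cases "w {a, b} = 0")
      case True
      then show ?thesis using r s f by (intro exI[of _ "s + flow w a b"]) auto
    next
      case False
      then show ?thesis
        using reach_small_height[OF w e r] circ[OF e] s f unfolding w_def by fastforce
    qed
  qed
  then have "(INF \<gamma>\<in>lattice_paths u v. SUP N\<in>{..path_len \<gamma>}. ennreal \<bar>path_sum x y \<gamma> N\<bar>)
      \<le> ennreal (7 * K)" for u v
  proof -
    obtain s where r: "reach w (7 * K) u v s"
      using \<open>\<exists>s. \<bar>s\<bar> \<le> 2 * K \<and> reach w (7 * K) u v s\<close> by blast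
    have "0 \<le> 7 * K"
      using K by simp
    from reach_path[OF r this] obtain \<gamma> where \<gamma>: "\<gamma> \<in> lattice_paths u v"
        "\<forall>N\<le>path_len \<gamma>. \<bar>height w \<gamma> N\<bar> \<le> 7 * K"
      by blast
    show ?thesis
      by (rule INF_lower2[OF \<gamma>(1)], intro SUP_least)
        (use \<gamma>(2) in \<open>auto simp: path_sum_eq_height w_def intro: ennreal_leI\<close>)
  qed
  then show ?thesis
    unfolding Sigma_bar_def by (intro SUP_least)
qed

section \<open>Configurations that block paths\<close>

definition l1 :: "vertex \<Rightarrow> int" where
  "l1 a = \<bar>fst a\<bar> + \<bar>snd a\<bar>"

definition ball_edges :: "int \<Rightarrow> edge set" where
  "ball_edges n = {{a, b} | a b. {a, b} \<in> E2 \<and> l1 a < n}"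

lemma ball_edgesI: "{a, b} \<in> E2 \<Longrightarrow> l1 a < n \<Longrightarrow> {a, b} \<in> ball_edges n"
  unfolding ball_edges_def mem_Collect_eq by (rule exI[of _ a], rule exI[of _ b]) simp

lemma finite_ball_edges: "finite (ball_edges n)"
proof -
  have "ball_edges n \<subseteq> Pow ({-n..n} \<times> {-n..n})"
  proof
    fix e assume "e \<in> ball_edges n"
    then obtain a b where "e = {a, b}" "{a, b} \<in> E2" "l1 a < n"
      unfolding ball_edges_def by blast
    then have "a \<in> {-n..n} \<times> {-n..n}" "b \<in> {-n..n} \<times> {-n..n}"
      unfolding edge_iff l1_def mem_Times_iff atLeastAtMost_iff by linarith+
    then show "e \<in> Pow ({-n..n} \<times> {-n..n})"
      using \<open>e = {a, b}\<close> by blast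
  qed
  then show ?thesis by (rule finite_subset) auto
qed

lemma ball_edges_subset: "ball_edges n \<subseteq> E2"
  by (auto simp: ball_edges_def)

lemma l1_edge:
  assumes "{a, b} \<in> E2"
  shows "\<bar>l1 b - l1 a\<bar> = 1"
proof -
  have "(\<bar>fst b - fst a\<bar> = 1 \<and> snd b = snd a) \<or> (\<bar>snd b - snd a\<bar> = 1 \<and> fst b = fst a)"
    using assms unfolding edge_iff by linarith
  moreover have "\<bar>\<bar>s\<bar> - \<bar>r\<bar>\<bar> = 1" if "\<bar>s - r\<bar> = 1" for r s :: int
    using that by (auto simp: abs_if split: if_splits)
  ultimately show ?thesis
    unfolding l1_def by force
qed

text \<open>The weights whose flow is the gradient of the \<open>\<ell>\<^sup>1\<close>-norm. An edge is an unordered pair, while flow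
and gradient refer to an order of its endpoints; both change sign when the order is reversed, so
the equation for one order determines the weight and implies the equation for the other.\<close>
definition outward :: "edge \<Rightarrow> real" where
  "outward e = (THE r. \<forall>a b. e = {a, b} \<longrightarrow> of_int (fst b - fst a + snd b - snd a) * r = of_int (l1 b - l1 a))"

lemma outward:
  assumes e: "{a, b} \<in> E2"
  shows "flow outward a b = of_int (l1 b - l1 a)" "outward {a, b} \<in> {-1, 1}"
proof -
  define \<sigma> where "\<sigma> = fst b - fst a + snd b - snd a"
  have \<sigma>: "\<sigma> \<in> {-1, 1}" and l: "l1 b - l1 a \<in> {-1, 1}"
    using flow_sign[OF e] l1_edge[OF e] unfolding \<sigma>_def by auto
  have "outward {a, b} = of_int (\<sigma> * (l1 b - l1 a))"
    unfolding outward_def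
  proof (rule the_equality)
    show "\<forall>c d. {a, b} = {c, d} \<longrightarrow>
        of_int (fst d - fst c + snd d - snd c) * of_int (\<sigma> * (l1 b - l1 a)) = (of_int (l1 d - l1 c) :: real)"
    proof (intro allI impI)
      fix c d assume "{a, b} = {c, d}"
      then consider "c = a" "d = b" | "c = b" "d = a"
        by (auto simp: doubleton_eq_iff)
      then have "(fst d - fst c + snd d - snd c) * (\<sigma> * (l1 b - l1 a)) = l1 d - l1 c"
      proof cases
        case 1
        then have "fst d - fst c + snd d - snd c = \<sigma>" by (simp add: \<sigma>_def)
        then show ?thesis using \<sigma> 1 by auto
      next
        case 2
        then have "fst d - fst c + snd d - snd c = - \<sigma>" by (simp add: \<sigma>_def)
        then show ?thesis using \<sigma> 2 by auto
      qed
      then show "of_int (fst d - fst c + snd d - snd c) * of_int (\<sigma> * (l1 b - l1 a)) = (of_int (l1 d - l1 c) :: real)"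
        by (simp only: flip: of_int_mult)
    qed
  next
    fix r :: real
    assume "\<forall>c d. {a, b} = {c, d} \<longrightarrow> of_int (fst d - fst c + snd d - snd c) * r = of_int (l1 d - l1 c)"
    then have "of_int \<sigma> * r = of_int (l1 b - l1 a)" by (auto simp: \<sigma>_def)
    then show "r = of_int (\<sigma> * (l1 b - l1 a))"
      using \<sigma> by auto
  qed
  then show "flow outward a b = of_int (l1 b - l1 a)" "outward {a, b} \<in> {-1, 1}"
    using \<sigma> l unfolding flow_def \<sigma>_def[symmetric] by auto
qed

text \<open>As long as a path has only left vertices of norm less than \<open>n\<close>, its height is \<open>r\<close> times the norm
of its position; this is still the case when it first reaches norm \<open>n\<close>.\<close>
lemma blocked_outward:
  assumes w: "\<And>e. e \<in> ball_edges (int n) \<Longrightarrow> w e = r * outward e"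
  shows "blocked w (real n * \<bar>r\<bar>) (0, 0) (int n, 0)"
  unfolding blocked_def
proof
  fix \<gamma> assume \<gamma>: "\<gamma> \<in> lattice_paths (0, 0) (int n, 0)"
  define N where "N = (LEAST N. int n \<le> l1 (\<gamma> ! N))"
  have end_ge: "int n \<le> l1 (\<gamma> ! path_len \<gamma>)"
    using lattice_path_ends[OF \<gamma>] by (simp add: l1_def)
  then have N: "int n \<le> l1 (\<gamma> ! N)" "N \<le> path_len \<gamma>"
    unfolding N_def by (rule LeastI, rule Least_le)
  have less: "l1 (\<gamma> ! k) < int n" if "k < N" for k
    using not_less_Least[of k "\<lambda>N. int n \<le> l1 (\<gamma> ! N)"] that unfolding N_def by auto
  have "height w \<gamma> k = r * of_int (l1 (\<gamma> ! k))" if "k \<le> N" for k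
    using that
  proof (induction k)
    case 0
    then show ?case using lattice_path_ends[OF \<gamma>] by (simp add: l1_def)
  next
    case (Suc k)
    have e: "{\<gamma> ! k, \<gamma> ! Suc k} \<in> E2"
      using lattice_path_edge[OF \<gamma>] Suc.prems N(2) by simp
    then have "{\<gamma> ! k, \<gamma> ! Suc k} \<in> ball_edges (int n)"
      using less[of k] Suc.prems by (intro ball_edgesI) auto
    then have "flow w (\<gamma> ! k) (\<gamma> ! Suc k) = r * flow outward (\<gamma> ! k) (\<gamma> ! Suc k)"
      using w by (simp add: flow_def)
    then show ?case
      using Suc outward(1)[OF e] by (simp add: algebra_simps)
  qed
  then have "\<bar>height w \<gamma> N\<bar> = of_int (l1 (\<gamma> ! N)) * \<bar>r\<bar>"
    using N(1) by (simp add: abs_mult)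
  moreover have "real n \<le> of_int (l1 (\<gamma> ! N))"
    using N(1) by linarith
  ultimately show "\<exists>N\<le>path_len \<gamma>. real n * \<bar>r\<bar> \<le> \<bar>height w \<gamma> N\<bar>"
    using N(2) by (metis abs_ge_zero mult_right_mono)
qed

text \<open>A path to another vertex has a first step, and it starts at the origin.\<close>
lemma blocked_large_edges:
  assumes w: "\<And>e. e \<in> ball_edges 1 \<Longrightarrow> t \<le> \<bar>w e\<bar>"
  shows "blocked w t (0, 0) (1, 0)"
  unfolding blocked_def
proof
  fix \<gamma> assume \<gamma>: "\<gamma> \<in> lattice_paths (0, 0) (1, 0)"
  have len: "0 < path_len \<gamma>"
    using lattice_path_ends[OF \<gamma>] by (cases "path_len \<gamma>") auto
  have e: "{(0, 0), \<gamma> ! 1} \<in> E2"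
    using lattice_path_edge[OF \<gamma> len] lattice_path_ends[OF \<gamma>] by simp
  then have "{(0, 0), \<gamma> ! 1} \<in> ball_edges 1"
    by (intro ball_edgesI) (simp_all add: l1_def)
  from w[OF this] have "t \<le> \<bar>height w \<gamma> 1\<bar>"
    using lattice_path_ends[OF \<gamma>] abs_flow[OF e, of w] by (simp add: height_def)
  then show "\<exists>N\<le>path_len \<gamma>. t \<le> \<bar>height w \<gamma> N\<bar>"
    using len by (intro exI[of _ 1]) auto
qed

section \<open>A zero-one law for product measures\<close>

text \<open>The sets that can be approximated form a \<open>\<sigma>\<close>-algebra. For a countable union, its first \<open>n\<close> members
already exhaust the measure up to \<open>\<epsilon> / 2\<close>, and these are approximated one by one, up to
\<open>\<epsilon> / (2 * (n + 1))\<close> each.\<close>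
lemma (in finite_measure) algebra_approximation:
  assumes \<A>: "algebra (space M) \<A>" and gen: "sets M = sigma_sets (space M) \<A>"
    and A: "A \<in> sets M" and \<epsilon>: "0 < (\<epsilon> :: real)"
  shows "\<exists>B\<in>\<A>. measure M (sym_diff A B) < \<epsilon>"
proof -
  interpret \<A>: algebra "space M" \<A> by fact
  have \<A>_sets: "B \<in> sets M" if "B \<in> \<A>" for B
    using that gen by auto
  have "A \<in> sigma_sets (space M) \<A>"
    using A gen by simp
  then show ?thesis
    using \<epsilon>
  proof (induction arbitrary: \<epsilon> rule: sigma_sets.induct)
    case (Basic A)
    then show ?case by (intro bexI[of _ A]) auto
  next
    case Empty
    then show ?case by (intro bexI[of _ "{}"]) auto
  next
    case (Compl A)
    then obtain B where B: "B \<in> \<A>" "measure M (sym_diff A B) < \<epsilon>" by blast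
    have "sym_diff (space M - A) (space M - B) = sym_diff A B"
      using sigma_sets_into_sp[OF \<A>.space_closed Compl.hyps] \<A>.sets_into_space[OF B(1)] by blast
    then show ?case
      using B by (intro bexI[of _ "space M - B"]) auto
  next
    case (Union A)
    have A_sets: "A i \<in> sets M" for i
      using Union.hyps gen by simp
    have "(\<lambda>n. measure M (\<Union>i<n. A i)) \<longlonglongrightarrow> measure M (\<Union>n. \<Union>i<n. A i)"
      using A_sets by (intro finite_Lim_measure_incseq) (auto simp: incseq_def intro: less_le_trans)
    moreover have "(\<Union>n. \<Union>i<n. A i) = (\<Union>i. A i)"
      by auto
    ultimately have "(\<lambda>n. measure M (\<Union>i<n. A i)) \<longlonglongrightarrow> measure M (\<Union>i. A i)"
      by simp
    from LIMSEQ_D[OF this, of "\<epsilon> / 2"] Union.prems obtain n where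
      n: "\<bar>measure M (\<Union>i<n. A i) - measure M (\<Union>i. A i)\<bar> < \<epsilon> / 2"
      by auto
    have "measure M ((\<Union>i. A i) - (\<Union>i<n. A i)) = measure M (\<Union>i. A i) - measure M (\<Union>i<n. A i)"
      using A_sets by (intro finite_measure_Diff) auto
    with n have tail: "measure M ((\<Union>i. A i) - (\<Union>i<n. A i)) < \<epsilon> / 2"
      by linarith
    define \<delta> where "\<delta> = \<epsilon> / (2 * (real n + 1))"
    have \<delta>: "0 < \<delta>"
      using Union.prems by (simp add: \<delta>_def)
    then have "\<exists>B\<in>\<A>. measure M (sym_diff (A i) B) < \<delta>" for i
      using Union.IH by blast
    then obtain B where B: "\<And>i. B i \<in> \<A>" "\<And>i. measure M (sym_diff (A i) (B i)) < \<delta>"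
      by metis
    have B_sets: "B i \<in> sets M" for i
      using B(1) \<A>_sets by blast
    have "measure M (sym_diff (\<Union>i. A i) (\<Union>i<n. B i))
        \<le> measure M (((\<Union>i. A i) - (\<Union>i<n. A i)) \<union> (\<Union>i<n. sym_diff (A i) (B i)))"
      using A_sets B_sets by (intro finite_measure_mono) auto
    also have "\<dots> \<le> measure M ((\<Union>i. A i) - (\<Union>i<n. A i)) + measure M (\<Union>i<n. sym_diff (A i) (B i))"
      using A_sets B_sets by (intro measure_Un_le) auto
    also have "measure M (\<Union>i<n. sym_diff (A i) (B i)) \<le> (\<Sum>i<n. measure M (sym_diff (A i) (B i)))"
      using A_sets B_sets by (intro measure_UNION_le) auto
    also have "\<dots> \<le> (\<Sum>i<n. \<delta>)"
      using B(2) by (intro sum_mono less_imp_le)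
    also have "\<dots> \<le> \<epsilon> / 2"
      using Union.prems by (simp add: \<delta>_def field_simps)
    finally have "measure M (sym_diff (\<Union>i. A i) (\<Union>i<n. B i)) < \<epsilon>"
      using tail by linarith
    moreover have "(\<Union>i<n. B i) \<in> \<A>"
      using B(1) by (intro \<A>.finite_UN) auto
    ultimately show ?case by blast
  qed
qed

lemma (in product_prob_space) measure_emb_Int_disjoint:
  assumes J: "finite J" "J \<subseteq> I" "B \<in> sets (PiM J M)" and K: "finite K" "K \<subseteq> I" "C \<in> sets (PiM K M)"
    and disj: "J \<inter> K = {}"
  shows "measure (PiM I M) (prod_emb I M J B \<inter> prod_emb I M K C) =
    measure (PiM I M) (prod_emb I M J B) * measure (PiM I M) (prod_emb I M K C)"
proof (cases "I = {}")
  case True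
  then have "measure (PiM {} M) {\<lambda>x. undefined} = 1"
    using P.prob_space by (simp add: space_PiM)
  then show ?thesis
    using J K True by (auto simp: prod_emb_def sets_PiM_empty)
next
  case False
  have "P.indep_vars M (\<lambda>i \<omega>. \<omega> i) I"
  proof (subst P.indep_vars_iff_distr_eq_PiM'[OF False])
    have "distr (PiM I M) (PiM I M) (\<lambda>x. \<lambda>i\<in>I. x i) = distr (PiM I M) (PiM I M) (\<lambda>x. x)"
      by (intro distr_cong) (auto simp: space_PiM PiE_restrict)
    also have "\<dots> = (\<Pi>\<^sub>M i\<in>I. distr (PiM I M) (M i) (\<lambda>\<omega>. \<omega> i))"
      by (auto simp: distr_id intro!: PiM_cong PiM_component[symmetric])
    finally show "distr (PiM I M) (PiM I M) (\<lambda>x. \<lambda>i\<in>I. x i) = \<dots>" .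
  qed auto
  from P.indep_varD[OF P.indep_var_restrict[OF this disj J(2) K(2)] J(3) K(3)]
  show ?thesis
    unfolding prod_emb_def space_PiM[symmetric]
    by (auto intro!: arg_cong[where f = "measure (PiM I M)"] simp: vimage_def restrict_def Int_def conj_ac)
qed

text \<open>The mixing argument. Let \<open>p\<close> be the probability of \<open>A\<close>. A cylinder set \<open>E\<close> over finitely many indices
\<open>J\<close> approximates \<open>A\<close>. A reindexing \<open>T\<close> that preserves \<open>A\<close> and moves \<open>J\<close> off itself turns
\<open>E\<close> into a cylinder set \<open>F\<close> that has the same probability, approximates \<open>A\<close> equally well, and is
independent of \<open>E\<close>. Hence \<open>p\<close> is close to the probability of \<open>E \<inter> F\<close>, which is the square of that of \<open>E\<close>
and so close to \<open>p * p\<close>.\<close>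
lemma (in product_prob_space) zero_one_law_reindexing_invariant:
  assumes A: "A \<in> sets (PiM I M)"
    and inv: "\<And>J. finite J \<Longrightarrow> J \<subseteq> I \<Longrightarrow> \<exists>T. inj_on T I \<and> T ` I \<subseteq> I \<and> T ` J \<inter> J = {} \<and>
      (\<forall>i\<in>I. M (T i) = M i) \<and> (\<forall>f\<in>space (PiM I M). (\<lambda>i\<in>I. f (T i)) \<in> A \<longleftrightarrow> f \<in> A)"
  shows "measure (PiM I M) A \<in> {0, 1}"
proof -
  define p where "p = measure (PiM I M) A"
  have "\<bar>p - p * p\<bar> < 4 * \<epsilon>" if \<epsilon>: "0 < \<epsilon>" for \<epsilon>
  proof -
    obtain B' where "B' \<in> generator" "measure (PiM I M) (sym_diff A B') < \<epsilon>"
      using P.algebra_approximation[OF algebra_generator sets_PiM_generator A \<epsilon>] by blast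
    then obtain J B where J: "finite J" "J \<subseteq> I" and B: "B \<in> sets (PiM J M)"
      and close: "measure (PiM I M) (sym_diff A (prod_emb I M J B)) < \<epsilon>"
      by (auto elim: generator.cases)
    obtain T where T: "inj_on T I" "T ` I \<subseteq> I" "T ` J \<inter> J = {}" "\<And>i. i \<in> I \<Longrightarrow> M (T i) = M i"
      and A_inv: "\<And>f. f \<in> space (PiM I M) \<Longrightarrow> (\<lambda>i\<in>I. f (T i)) \<in> A \<longleftrightarrow> f \<in> A"
      using inv[OF J] by blast
    define \<tau> where "\<tau> = (\<lambda>f. \<lambda>i\<in>I. f (T i) :: 'a)"
    define E where "E = prod_emb I M J B"
    define F where "F = \<tau> -` E \<inter> space (PiM I M)"
    have E: "E \<in> sets (PiM I M)"
      using J B by (simp add: E_def)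
    have PiM_T: "(\<Pi>\<^sub>M i\<in>I. M (T i)) = PiM I M"
      by (intro PiM_cong) (auto simp: T(4))
    have distr_\<tau>: "distr (PiM I M) (PiM I M) \<tau> = PiM I M"
      using distr_PiM_reindex[of I M T I] T(1,2) M.prob_space_axioms
      by (simp add: PiM_T \<tau>_def image_subset_iff_funcset)
    have \<tau>[measurable]: "\<tau> \<in> measurable (PiM I M) (PiM I M)"
      unfolding \<tau>_def
    proof (rule measurable_restrict)
      fix i assume i: "i \<in> I"
      then have "T i \<in> I" using T(2) by blast
      then show "(\<lambda>f. f (T i)) \<in> measurable (PiM I M) (M i)"
        using measurable_component_singleton[of "T i" I M] T(4)[OF i] by simp
    qed
    have preserve: "measure (PiM I M) (\<tau> -` S \<inter> space (PiM I M)) = measure (PiM I M) S"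
      if "S \<in> sets (PiM I M)" for S
      using measure_distr[OF \<tau> that] distr_\<tau> by simp
    have F: "F \<in> sets (PiM I M)" 
      using E \<tau> by (auto simp: F_def)
    have "measure (PiM I M) (sym_diff A F) = measure (PiM I M) (sym_diff A E)"
    proof -
      have "sym_diff A F = \<tau> -` (sym_diff A E) \<inter> space (PiM I M)"
        using A_inv sets.sets_into_space[OF A] by (auto simp: F_def \<tau>_def)
      then show ?thesis
        using preserve[of "sym_diff A E"] A E by simp
    qed
    then have close_F: "measure (PiM I M) (sym_diff A F) < \<epsilon>"
      and close_E: "measure (PiM I M) (sym_diff A E) < \<epsilon>"
      using close by (auto simp: E_def)
    \<comment> \<open>\<open>F\<close> is a cylinder set over \<open>T ` J\<close>, which is disjoint from \<open>J\<close>.\<close>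
    have "F = prod_emb I M (T ` J) {g \<in> space (PiM (T ` J) M). (\<lambda>i\<in>J. g (T i)) \<in> B}"
    proof -
      have "restrict (\<tau> f) J = (\<lambda>i\<in>J. restrict f (T ` J) (T i))" for f
        using J(2) by (auto simp: \<tau>_def restrict_def fun_eq_iff)
      moreover have "\<tau> f \<in> space (PiM I M)" "restrict f (T ` J) \<in> space (PiM (T ` J) M)"
        if "f \<in> space (PiM I M)" for f
      proof -
        show "\<tau> f \<in> space (PiM I M)"
          by (rule measurable_space[OF \<tau> that])
        have "T ` J \<subseteq> I"
          using J(2) T(2) by blast
        from measurable_space[OF measurable_restrict_subset[OF this] that]
        show "restrict f (T ` J) \<in> space (PiM (T ` J) M)" .
      qed
      ultimately show ?thesis
        unfolding F_def E_def prod_emb_def space_PiM[symmetric] by auto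
    qed
    moreover have "{g \<in> space (PiM (T ` J) M). (\<lambda>i\<in>J. g (T i)) \<in> B} \<in> sets (PiM (T ` J) M)"
    proof -
      have "(\<lambda>g. \<lambda>i\<in>J. g (T i)) \<in> measurable (PiM (T ` J) M) (PiM J M)"
      proof (rule measurable_restrict)
        fix i assume i: "i \<in> J"
        have "(\<lambda>f. f (T i)) \<in> measurable (PiM (T ` J) M) (M (T i))"
          by (rule measurable_component_singleton[OF imageI[OF i]])
        then show "(\<lambda>f. f (T i)) \<in> measurable (PiM (T ` J) M) (M i)"
          unfolding T(4)[OF subsetD[OF J(2) i]] .
      qed
      from measurable_sets[OF this B] show ?thesis
        by (simp add: vimage_def Int_def conj_commute)
    qed
    ultimately have "measure (PiM I M) (E \<inter> F) = measure (PiM I M) E * measure (PiM I M) F"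
      unfolding E_def using J B T(2,3) by (auto intro!: measure_emb_Int_disjoint)
    also have "measure (PiM I M) F = measure (PiM I M) E"
      using preserve[OF E] by (simp add: F_def)
    finally have mix: "measure (PiM I M) (E \<inter> F) = measure (PiM I M) E * measure (PiM I M) E" .
    define q where "q = measure (PiM I M) E"
    have diff: "\<bar>measure (PiM I M) S - measure (PiM I M) S'\<bar> \<le> measure (PiM I M) (sym_diff S S')"
      if "S \<in> sets (PiM I M)" "S' \<in> sets (PiM I M)" for S S'
    proof -
      have "measure (PiM I M) S \<le> measure (PiM I M) (S' \<union> sym_diff S S')"
        "measure (PiM I M) S' \<le> measure (PiM I M) (S \<union> sym_diff S S')"
        using that by (auto intro!: P.finite_measure_mono)
      moreover have "measure (PiM I M) (S' \<union> sym_diff S S') \<le> measure (PiM I M) S' + measure (PiM I M) (sym_diff S S')"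
        "measure (PiM I M) (S \<union> sym_diff S S') \<le> measure (PiM I M) S + measure (PiM I M) (sym_diff S S')"
        using that by (auto intro!: measure_Un_le)
      ultimately show ?thesis by linarith
    qed
    have 1: "\<bar>p - q\<bar> < \<epsilon>"
      using diff[OF A E] close_E by (simp add: p_def q_def)
    have "measure (PiM I M) (sym_diff A (E \<inter> F)) \<le> measure (PiM I M) (sym_diff A E \<union> sym_diff A F)"
      using A E F by (intro P.finite_measure_mono) auto
    also have "\<dots> \<le> measure (PiM I M) (sym_diff A E) + measure (PiM I M) (sym_diff A F)"
      using A E F by (intro measure_Un_le) auto
    finally have 2: "\<bar>p - q * q\<bar> < 2 * \<epsilon>"
      using diff[of A "E \<inter> F"] A E F close_E close_F by (simp add: p_def q_def mix)
    have "q * q - p * p = (q - p) * (q + p)"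
      by (simp add: algebra_simps)
    then have "\<bar>q * q - p * p\<bar> = \<bar>q - p\<bar> * (q + p)"
      by (simp add: abs_mult p_def q_def)
    moreover have "q + p \<le> 2"
      unfolding p_def q_def using P.prob_le_1[of A] P.prob_le_1[of E] by linarith
    then have "\<bar>q - p\<bar> * (q + p) \<le> \<bar>q - p\<bar> * 2"
      by (intro mult_left_mono) auto
    ultimately have 3: "\<bar>q * q - p * p\<bar> \<le> \<bar>p - q\<bar> * 2"
      by (simp add: abs_minus_commute)
    have "\<bar>p - p * p\<bar> \<le> \<bar>p - q * q\<bar> + \<bar>q * q - p * p\<bar>"
      using abs_triangle_ineq[of "p - q * q" "q * q - p * p"] by simp
    also have "\<dots> < 2 * \<epsilon> + \<epsilon> * 2"
      using 1 2 3 by (intro add_less_le_mono) auto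
    finally show ?thesis
      by simp
  qed
  from this[of "\<bar>p - p * p\<bar> / 4"] have "p = p * p"
    by (cases "\<bar>p - p * p\<bar> = 0") auto
  then show ?thesis
    by (simp add: p_def)
qed

section \<open>Independent sums and supports\<close>

text \<open>For each fixed value \<open>r\<close> of \<open>R\<close>, the excluded event asks \<open>U\<close> to hit the single nonzero value \<open>- r\<close>
(or is empty, if \<open>r = 0\<close>), so it is null by Fubini's theorem.\<close>
lemma (in prob_space) AE_add_indep_neq_0:
  fixes U R :: "'a \<Rightarrow> real"
  assumes indep: "indep_var borel U borel R"
    and no_atom: "\<And>r. r \<noteq> 0 \<Longrightarrow> prob (U -` {r} \<inter> space M) = 0"
  shows "AE \<omega> in M. U \<omega> \<noteq> 0 \<longrightarrow> U \<omega> + R \<omega> \<noteq> 0"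
proof -
  have rv[measurable]: "random_variable borel U" "random_variable borel R"
    using indep by (rule indep_var_rv1, rule indep_var_rv2)
  interpret U: prob_space "distr M borel U" by (rule prob_space_distr) (rule rv)
  interpret R: prob_space "distr M borel R" by (rule prob_space_distr) (rule rv)
  interpret UR: pair_prob_space "distr M borel U" "distr M borel R" ..
  define S where "S = {z \<in> space (borel \<Otimes>\<^sub>M borel). fst z \<noteq> 0 \<and> fst z + snd z = (0 :: real)}"
  have S[measurable]: "S \<in> sets (borel \<Otimes>\<^sub>M borel)"
    unfolding S_def by measurable
  have null: "emeasure (distr M borel U) ((\<lambda>u. (u, r)) -` S) = 0" for r
  proof (cases "r = 0")
    case True
    then have "(\<lambda>u. (u, r)) -` S = {}" by (auto simp: S_def)
    then show ?thesis by simp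
  next
    case False
    have "(\<lambda>u. (u, r)) -` S = {- r}"
      using False by (auto simp: S_def space_pair_measure)
    moreover have "prob (U -` {- r} \<inter> space M) = 0"
      using no_atom[of "- r"] False by simp
    ultimately show ?thesis
      by (simp add: emeasure_distr emeasure_eq_measure)
  qed
  have "emeasure (distr M borel U \<Otimes>\<^sub>M distr M borel R) S = 0"
    by (subst UR.emeasure_pair_measure_alt2) (auto simp: null)
  then have "emeasure (distr M (borel \<Otimes>\<^sub>M borel) (\<lambda>\<omega>. (U \<omega>, R \<omega>))) S = 0"
    using indep unfolding indep_var_distribution_eq by simp
  then have "emeasure M ((\<lambda>\<omega>. (U \<omega>, R \<omega>)) -` S \<inter> space M) = 0"
    by (simp add: emeasure_distr)
  then show ?thesis
    by (rule AE_I[rotated]) (auto simp: S_def space_pair_measure)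
qed

lemma law_support_compl: "- law_support L = \<Union>{U. open U \<and> measure L U = 0}"
  by (auto simp: law_support_def zero_less_measure_iff)

text \<open>The complement of the support is a union of open null sets, and by Lindelof's theorem countably many
of them have the same union.\<close>
lemma measure_law_support_compl:
  assumes "real_distribution L"
  shows "measure L (- law_support L) = 0"
proof -
  interpret real_distribution L by fact
  define \<F> where "\<F> = {U :: real set. open U \<and> measure L U = 0}"
  obtain \<G> where \<G>: "\<G> \<subseteq> \<F>" "countable \<G>" "\<Union>\<G> = \<Union>\<F>"
    by (rule Lindelof[of \<F>]) (auto simp: \<F>_def)
  have "U \<in> null_sets L" if "U \<in> \<G>" for U
    using that \<G>(1) by (auto simp: \<F>_def null_sets_def emeasure_eq_measure)
  then have "\<Union>\<G> \<in> null_sets L"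
    using null_sets_UN'[OF \<G>(2), of "\<lambda>U. U"] by simp
  moreover have "- law_support L = \<Union>\<F>"
    by (simp add: law_support_compl \<F>_def)
  ultimately show ?thesis
    by (simp add: \<G>(3) measure_eq_0_null_sets)
qed

section \<open>Edges under translations\<close>

lemma horizontal_iff:
  assumes "{a, b} \<in> E2"
  shows "horizontal {a, b} \<longleftrightarrow> \<bar>fst a - fst b\<bar> = 1"
proof
  assume "horizontal {a, b}"
  then obtain x1 y1 x2 y2 where "{a, b} = {(x1, y1), (x2, y2)}" "\<bar>x1 - x2\<bar> = 1"
    unfolding horizontal_def by blast
  then show "\<bar>fst a - fst b\<bar> = 1"
    by (auto simp: doubleton_eq_iff abs_minus_commute)
next
  assume "\<bar>fst a - fst b\<bar> = 1"
  then show "horizontal {a, b}"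
    unfolding horizontal_def using assms by (metis prod.collapse)
qed

lemma vertical_if_not_horizontal:
  assumes "e \<in> E2" "\<not> horizontal e"
  shows "vertical e"
proof -
  from assms(1) obtain a b where e: "e = {a, b}" "{a, b} \<in> E2"
    by (rule E2_cases)
  have "\<bar>fst a - fst b\<bar> \<noteq> 1"
    using assms(2) horizontal_iff[OF e(2)] e(1) by simp
  then have "\<bar>snd a - snd b\<bar> = 1"
    using e(2) unfolding edge_iff by linarith
  then show ?thesis
    unfolding vertical_def using e by (metis prod.collapse)
qed

lemma translate_edge:
  assumes "e \<in> E2"
  shows "translate k ` e \<in> E2" "horizontal (translate k ` e) = horizontal e"
proof -
  from assms obtain a b where e: "e = {a, b}" "{a, b} \<in> E2"
    by (rule E2_cases)
  then show "translate k ` e \<in> E2" by simp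
  have "{translate k a, translate k b} \<in> E2"
    using e(2) by simp
  then show "horizontal (translate k ` e) = horizontal e"
    unfolding e(1) image_insert image_empty by (simp only: horizontal_iff e(2)) (simp add: translate_def)
qed

lemma translate_away:
  assumes "finite J" "J \<subseteq> E2"
  shows "\<exists>k. (\<lambda>e. translate k ` e) ` J \<inter> J = {}"
proof -
  have fin: "finite e" "e \<noteq> {}" if "e \<in> J" for e
  proof -
    have "e \<in> E2" using assms(2) that by blast
    then obtain a b where "e = {a, b}" by (rule E2_cases)
    then show "finite e" "e \<noteq> {}" by auto
  qed
  define B where "B = Max ((\<lambda>a. \<bar>fst a\<bar>) ` \<Union>J)"
  have B: "\<bar>fst a\<bar> \<le> B" if "e \<in> J" "a \<in> e" for e a
    unfolding B_def using assms(1) fin that by (intro Max_ge) auto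
  have "translate (2 * B + 1) ` e \<notin> J" if e: "e \<in> J" for e
  proof
    assume J: "translate (2 * B + 1) ` e \<in> J"
    obtain a where "a \<in> e" using fin(2)[OF e] by blast
    then have "\<bar>fst a\<bar> \<le> B" "\<bar>fst (translate (2 * B + 1) a)\<bar> \<le> B"
      using B e J by blast+
    then show False by (simp add: translate_def)
  qed
  then show ?thesis by blast
qed

section \<open>The law of the signed weights\<close>

context random_environment
begin

definition weight :: "edge \<Rightarrow> 'a \<Rightarrow> real" where
  "weight e \<omega> = Y e \<omega> * X e \<omega>"

lemma measurable_X [measurable]: "e \<in> E2 \<Longrightarrow> X e \<in> borel_measurable M"
  and measurable_Y [measurable]: "e \<in> E2 \<Longrightarrow> Y e \<in> borel_measurable M"
  using indep_X indep_Y by (auto simp: indep_vars_def)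

lemma measurable_weight [measurable]: "e \<in> E2 \<Longrightarrow> weight e \<in> borel_measurable M"
  unfolding weight_def by measurable

lemma prob_XY_rectangles:
  assumes J: "J \<noteq> {}" "finite J" "J \<subseteq> E2"
    and A: "\<And>e. e \<in> J \<Longrightarrow> A e \<in> sets borel" and B: "\<And>e. e \<in> J \<Longrightarrow> B e \<in> sets borel"
  shows "prob (\<Inter>e\<in>J. X e -` A e \<inter> Y e -` B e \<inter> space M) =
    (\<Prod>e\<in>J. prob (X e -` A e \<inter> space M) * prob (Y e -` B e \<inter> space M))"
proof -
  let ?emb = "\<lambda>A. prod_emb E2 (\<lambda>_. borel) J (\<Pi>\<^sub>E e\<in>J. A e)"
  let ?X = "\<lambda>\<omega>. \<lambda>e\<in>E2. X e \<omega>" and ?Y = "\<lambda>\<omega>. \<lambda>e\<in>E2. Y e \<omega>"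
  have emb_iff: "(\<lambda>e\<in>E2. Z e \<omega>) \<in> ?emb A \<longleftrightarrow> (\<forall>e\<in>J. Z e \<omega> \<in> A e)"
    for Z :: "edge \<Rightarrow> 'a \<Rightarrow> real" and A \<omega>
  proof -
    have "restrict (\<lambda>e\<in>E2. Z e \<omega>) J = (\<lambda>e\<in>J. Z e \<omega>)"
      using J(3) by (auto simp: fun_eq_iff restrict_def)
    then show ?thesis
      by (simp add: prod_emb_iff PiE_iff)
  qed
  have X_eq: "?X -` ?emb A \<inter> space M = (\<Inter>e\<in>J. X e -` A e \<inter> space M)"
    using J(1) by (auto simp: emb_iff)
  have Y_eq: "?Y -` ?emb B \<inter> space M = (\<Inter>e\<in>J. Y e -` B e \<inter> space M)"
    using J(1) by (auto simp: emb_iff)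
  have "(\<Inter>e\<in>J. X e -` A e \<inter> Y e -` B e \<inter> space M) =
      (\<lambda>\<omega>. (?X \<omega>, ?Y \<omega>)) -` (?emb A \<times> ?emb B) \<inter> space M"
    using J(1) by (auto simp: emb_iff)
  also have "prob \<dots> = prob (?X -` ?emb A \<inter> space M) * prob (?Y -` ?emb B \<inter> space M)"
    using J A B by (intro indep_varD[OF indep_X_Y] sets_PiM_I) auto
  also have "\<dots> = (\<Prod>e\<in>J. prob (X e -` A e \<inter> space M)) * (\<Prod>e\<in>J. prob (Y e -` B e \<inter> space M))"
    unfolding X_eq Y_eq using indep_varsD[OF indep_X J A] indep_varsD[OF indep_Y J B] by simp
  finally show ?thesis
    by (simp add: prod.distrib)
qed

lemma prob_XY_rectangle:
  assumes "e \<in> E2" "A \<in> sets borel" "B \<in> sets borel"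
  shows "prob (X e -` A \<inter> Y e -` B \<inter> space M) =
    prob (X e -` A \<inter> space M) * prob (Y e -` B \<inter> space M)"
  using prob_XY_rectangles[of "{e}" "\<lambda>_. A" "\<lambda>_. B"] assms by simp

text \<open>Independence holds for the events that prescribe \<open>X e \<in> A\<close> and \<open>Y e \<in> B\<close> at each edge. For a single edge these
form a \<open>\<pi>\<close>-system generating a \<open>\<sigma>\<close>-algebra with respect to which \<open>weight e\<close> is measurable.\<close>
lemma indep_weight: "indep_vars (\<lambda>_. borel) weight E2"
proof -
  define R where "R e = {X e -` A \<inter> Y e -` B \<inter> space M | A B. A \<in> sets borel \<and> B \<in> sets borel}" for e
  have "indep_sets R E2"
  proof (rule indep_setsI)
    fix e assume "e \<in> E2"
    then show "R e \<subseteq> events"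
      by (auto simp: R_def)
  next
    fix S J assume J: "J \<noteq> {}" "J \<subseteq> E2" "finite J" and S: "\<forall>e\<in>J. S e \<in> R e"
    have "\<forall>e\<in>J. \<exists>A B. S e = X e -` A \<inter> Y e -` B \<inter> space M \<and> A \<in> sets borel \<and> B \<in> sets borel"
      using S unfolding R_def by blast
    then obtain A B where AB: "\<And>e. e \<in> J \<Longrightarrow> S e = X e -` A e \<inter> Y e -` B e \<inter> space M"
      "\<And>e. e \<in> J \<Longrightarrow> A e \<in> sets borel" "\<And>e. e \<in> J \<Longrightarrow> B e \<in> sets borel"
      by metis
    have "prob (\<Inter>e\<in>J. S e) = prob (\<Inter>e\<in>J. X e -` A e \<inter> Y e -` B e \<inter> space M)"
      using AB(1) by simp
    also have "\<dots> = (\<Prod>e\<in>J. prob (X e -` A e \<inter> space M) * prob (Y e -` B e \<inter> space M))"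
      using J AB by (intro prob_XY_rectangles) auto
    also have "\<dots> = (\<Prod>e\<in>J. prob (S e))"
      using J AB by (intro prod.cong) (auto simp: prob_XY_rectangle subset_iff)
    finally show "prob (\<Inter>e\<in>J. S e) = (\<Prod>e\<in>J. prob (S e))" .
  qed
  moreover have "Int_stable (R e)" for e
  proof (rule Int_stableI)
    fix S S' assume "S \<in> R e" "S' \<in> R e"
    then obtain A B A' B' where "S = X e -` A \<inter> Y e -` B \<inter> space M" "S' = X e -` A' \<inter> Y e -` B' \<inter> space M"
      and AB: "A \<in> sets borel" "B \<in> sets borel" "A' \<in> sets borel" "B' \<in> sets borel"
      unfolding R_def by blast
    then have "S \<inter> S' = X e -` (A \<inter> A') \<inter> Y e -` (B \<inter> B') \<inter> space M"
      by blast
    moreover have "A \<inter> A' \<in> sets borel" "B \<inter> B' \<in> sets borel"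
      using AB by auto
    ultimately show "S \<inter> S' \<in> R e"
      unfolding R_def by blast
  qed
  ultimately have indep: "indep_sets (\<lambda>e. sigma_sets (space M) (R e)) E2"
    by (rule indep_sets_sigma)
  have "{weight e -` A \<inter> space M | A. A \<in> sets borel} \<subseteq> sigma_sets (space M) (R e)" for e
  proof -
    define N where "N = sigma (space M) (R e)"
    have R_Pow: "R e \<subseteq> Pow (space M)"
      by (auto simp: R_def)
    have N: "space N = space M" "sets N = sigma_sets (space M) (R e)"
      using R_Pow by (auto simp: N_def)
    have "X e -` A \<inter> space M \<in> R e" if "A \<in> sets borel" for A
      unfolding R_def mem_Collect_eq
      by (rule exI[of _ A], rule exI[of _ UNIV]) (use that in auto)
    then have "X e \<in> borel_measurable N"
      by (intro measurableI) (auto simp: N)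
    moreover have "Y e -` B \<inter> space M \<in> R e" if "B \<in> sets borel" for B
      unfolding R_def mem_Collect_eq
      by (rule exI[of _ UNIV], rule exI[of _ B]) (use that in auto)
    then have "Y e \<in> borel_measurable N"
      by (intro measurableI) (auto simp: N)
    ultimately have "weight e \<in> borel_measurable N"
      unfolding weight_def by measurable
    then show ?thesis
      using N by (auto dest: measurable_sets)
  qed
  then have "indep_sets (\<lambda>e. {weight e -` A \<inter> space M | A. A \<in> sets borel}) E2"
    by (intro indep_sets_mono_sets[OF indep])
  then show ?thesis
    unfolding indep_vars_def2 by (simp add: measurable_weight)
qed

definition sign_prob :: "edge \<Rightarrow> real" where
  "sign_prob e = (if horizontal e then p_o else p_v)"

lemma prob_weight:
  assumes e: "e \<in> E2" and A: "A \<in> sets borel"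
  shows "prob (weight e -` A \<inter> space M) =
    sign_prob e * measure L A + (1 - sign_prob e) * measure L (uminus -` A)"
proof -
  have L: "prob (X e -` B \<inter> space M) = measure L B" if "B \<in> sets borel" for B
    using law_X[OF e] measure_distr[OF measurable_X[OF e] that] by simp
  have A': "uminus -` A \<in> sets borel"
    using measurable_sets[of uminus borel borel A] A by simp
  have "Y e -` {1} \<inter> space M = {\<omega> \<in> space M. Y e \<omega> = 1}"
    by auto
  then have plus: "prob (Y e -` {1} \<inter> space M) = sign_prob e"
    using Y_horizontal[of e] Y_vertical[of e] vertical_if_not_horizontal[OF e]
    by (auto simp: sign_prob_def)
  have "Y e -` {-1} \<inter> space M = space M - (Y e -` {1} \<inter> space M)"
    using Y_values[OF e] by auto
  then have minus: "prob (Y e -` {-1} \<inter> space M) = 1 - sign_prob e"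
    using plus e by (simp add: prob_compl)
  have "weight e -` A \<inter> space M =
      (X e -` A \<inter> Y e -` {1} \<inter> space M) \<union> (X e -` (uminus -` A) \<inter> Y e -` {-1} \<inter> space M)"
    using Y_values[OF e] by (fastforce simp: weight_def)
  also have "prob \<dots> = prob (X e -` A \<inter> Y e -` {1} \<inter> space M) +
      prob (X e -` (uminus -` A) \<inter> Y e -` {-1} \<inter> space M)"
    using e A A' by (intro finite_measure_Union) auto
  also have "\<dots> = measure L A * sign_prob e + measure L (uminus -` A) * (1 - sign_prob e)"
    using A A' by (simp add: prob_XY_rectangle[OF e] L plus minus)
  finally show ?thesis
    by (simp add: mult.commute)
qed

section \<open>The almost sure value of the optimal height\<close>

text \<open>The joint law of the weights is a product measure whose factors are not changed by translations,
because these preserve the orientation of edges. So the zero-one law applies to the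
translation invariant event that some pair of vertices is blocked.\<close>
lemma AE_blocked_zero_one:
  "(AE \<omega> in M. \<exists>u v. blocked (\<lambda>e. weight e \<omega>) t u v) \<or>
   (AE \<omega> in M. \<not> (\<exists>u v. blocked (\<lambda>e. weight e \<omega>) t u v))"
proof -
  \<comment> \<open>The value for sets that are not edges is an arbitrary probability measure.\<close>
  define D where "D e = (if e \<in> E2 then distr M borel (weight e) else return borel 0)" for e
  have D: "prob_space (D e)" for e
    by (auto simp: D_def intro: prob_space_distr prob_space_return)
  have [measurable_cong]: "sets (D e) = sets borel" for e
    by (simp add: D_def)
  have borel: "sets (PiM E2 D) = sets (PiM E2 (\<lambda>_. borel))"
    by (intro sets_PiM_cong) (auto simp: D_def)
  have joint: "distr M (PiM E2 (\<lambda>_. borel)) (\<lambda>\<omega>. \<lambda>e\<in>E2. weight e \<omega>) = PiM E2 D"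
  proof -
    have "{(0, 0), (1, 0)} \<in> E2" by (simp add: edge_iff)
    then have "E2 \<noteq> {}" by blast
    from indep_vars_iff_distr_eq_PiM'[THEN iffD1, OF this _ indep_weight]
    have "distr M (PiM E2 (\<lambda>_. borel)) (\<lambda>\<omega>. \<lambda>e\<in>E2. weight e \<omega>) = PiM E2 (\<lambda>e. distr M borel (weight e))"
      by simp
    also have "\<dots> = PiM E2 D"
      by (intro PiM_cong) (auto simp: D_def)
    finally show ?thesis .
  qed
  have D_translate: "D (translate k ` e) = D e" if e: "e \<in> E2" for e k
  proof -
    have "sign_prob (translate k ` e) = sign_prob e"
      using translate_edge(2)[OF e] by (simp add: sign_prob_def)
    then show ?thesis
      using e translate_edge(1)[OF e]
      by (intro measure_eqI) (auto simp: D_def emeasure_distr emeasure_eq_measure prob_weight)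
  qed
  define A where "A = {w \<in> space (PiM E2 D). \<exists>u v. blocked w t u v}"
  have flow: "(\<lambda>w. flow w a b) \<in> borel_measurable (PiM E2 D)" if "{a, b} \<in> E2" for a b
    unfolding flow_def using that by measurable
  have height: "(\<lambda>w. height w \<gamma> N) \<in> borel_measurable (PiM E2 D)"
    if "\<gamma> \<in> lattice_paths u v" "N \<le> path_len \<gamma>" for \<gamma> N u v
    using that(2)
  proof (induction N)
    case (Suc N)
    then have "{\<gamma> ! N, \<gamma> ! Suc N} \<in> E2"
      using lattice_path_edge[OF that(1)] by simp
    from flow[OF this] Suc show ?case by simp
  qed simp
  have blocked_iff: "blocked w t u v \<longleftrightarrow>
      (\<forall>\<gamma>\<in>lattice_paths u v. \<exists>N\<in>{..path_len \<gamma>}. t \<le> \<bar>height w \<gamma> N\<bar>)" for w u v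
    unfolding blocked_def Bex_def atMost_iff ..
  have "Measurable.pred (PiM E2 D) (\<lambda>w. \<exists>u v. blocked w t u v)"
    unfolding blocked_iff
  proof (intro pred_intros_countable pred_intros_countable_bounded)
    fix u v \<gamma> N assume "\<gamma> \<in> lattice_paths u v" "N \<in> {..path_len \<gamma>}"
    then have [measurable]: "(\<lambda>w. height w \<gamma> N) \<in> borel_measurable (PiM E2 D)"
      by (intro height) auto
    show "Measurable.pred (PiM E2 D) (\<lambda>w. t \<le> \<bar>height w \<gamma> N\<bar>)"
      by measurable
  qed
  then have A: "A \<in> sets (PiM E2 D)"
    unfolding A_def by measurable
  have "measure (PiM E2 D) A \<in> {0, 1}"
  proof (rule product_prob_space.zero_one_law_reindexing_invariant[OF product_prob_spaceI A])
    fix J assume "finite J" "J \<subseteq> E2"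
    then obtain k where k: "(\<lambda>e. translate k ` e) ` J \<inter> J = {}"
      using translate_away by blast
    have "inj_on ((`) (translate k)) E2"
      by (intro inj_on_inverseI[of _ "(`) (translate (- k))"]) (simp add: image_image)
    moreover have "(`) (translate k) ` E2 \<subseteq> E2"
      using translate_edge(1) by blast
    moreover have "(\<lambda>e\<in>E2. f (translate k ` e)) \<in> A \<longleftrightarrow> f \<in> A" if f: "f \<in> space (PiM E2 D)" for f
    proof -
      have "(\<lambda>e\<in>E2. f (translate k ` e)) \<in> space (PiM E2 D)"
        by (auto simp: space_PiM D_def)
      moreover have "(\<exists>u v. blocked (\<lambda>e\<in>E2. f (translate k ` e)) t u v) \<longleftrightarrow>
          (\<exists>u v. blocked (\<lambda>e. f (translate k ` e)) t u v)"
        by (intro arg_cong[where f = Ex] ext blocked_cong) simp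
      ultimately show ?thesis
        using f by (simp only: A_def mem_Collect_eq blocked_translate_iff)
    qed
    ultimately show "\<exists>T. inj_on T E2 \<and> T ` E2 \<subseteq> E2 \<and> T ` J \<inter> J = {} \<and>
        (\<forall>e\<in>E2. D (T e) = D e) \<and> (\<forall>f\<in>space (PiM E2 D). (\<lambda>e\<in>E2. f (T e)) \<in> A \<longleftrightarrow> f \<in> A)"
      using k D_translate by (intro exI[of _ "(`) (translate k)"]) blast
  qed (rule D)
  moreover have W: "(\<lambda>\<omega>. \<lambda>e\<in>E2. weight e \<omega>) \<in> measurable M (PiM E2 (\<lambda>_. borel))"
    by (intro measurable_restrict) measurable
  have pre: "(\<lambda>\<omega>. \<lambda>e\<in>E2. weight e \<omega>) -` A \<inter> space M = {\<omega> \<in> space M. \<exists>u v. blocked (\<lambda>e. weight e \<omega>) t u v}"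
  proof -
    have "blocked (\<lambda>e\<in>E2. weight e \<omega>) t u v \<longleftrightarrow> blocked (\<lambda>e. weight e \<omega>) t u v" for \<omega> u v
      by (intro blocked_cong) simp
    moreover have "(\<lambda>e\<in>E2. weight e \<omega>) \<in> space (PiM E2 D)" for \<omega>
      by (auto simp: space_PiM D_def)
    ultimately show ?thesis
      by (auto simp: A_def)
  qed
  ultimately have "prob {\<omega> \<in> space M. \<exists>u v. blocked (\<lambda>e. weight e \<omega>) t u v} \<in> {0, 1}"
    using measure_distr[OF W, of A] A borel by (simp add: joint pre)
  moreover have "{\<omega> \<in> space M. \<exists>u v. blocked (\<lambda>e. weight e \<omega>) t u v} \<in> events"
    using measurable_sets[OF W, of A] A borel pre by simp
  ultimately show ?thesis
    by (auto simp: prob_Collect_eq_1 prob_Collect_eq_0)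
qed

text \<open>Almost surely the truth value of each of the countably many events for rational levels is the
prescribed one, and these truth values determine \<^const>\<open>Sigma_bar\<close>, since the rationals are dense.\<close>
lemma Sigma_bar_AE_const: "\<exists>c. AE \<omega> in M. Sigma_bar (\<lambda>e. X e \<omega>) (\<lambda>e. Y e \<omega>) = c"
proof -
  define \<Sigma> where "\<Sigma> \<omega> = Sigma_bar (\<lambda>e. X e \<omega>) (\<lambda>e. Y e \<omega>)" for \<omega>
  define Q where "Q t \<omega> \<longleftrightarrow> (\<exists>u v. blocked (\<lambda>e. weight e \<omega>) t u v)" for t \<omega>
  have Q_le: "ennreal t \<le> \<Sigma> \<omega>" if "Q t \<omega>" for t \<omega>
    using that blocked_le_Sigma_bar[of "\<lambda>e. Y e \<omega>" "\<lambda>e. X e \<omega>" t]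
    unfolding Q_def \<Sigma>_def weight_def by blast
  have Q_less: "Q t \<omega>" if "ennreal t < \<Sigma> \<omega>" for t \<omega>
    using less_Sigma_bar_blocked that unfolding Q_def \<Sigma>_def weight_def by blast
  have "\<exists>b. AE \<omega> in M. Q t \<omega> = b" for t
    using AE_blocked_zero_one[of t] unfolding Q_def[symmetric]
  proof
    assume "AE \<omega> in M. Q t \<omega>"
    then show ?thesis by (intro exI[of _ True]) simp
  next
    assume "AE \<omega> in M. \<not> Q t \<omega>"
    then show ?thesis by (intro exI[of _ False]) simp
  qed
  then obtain b where b: "\<And>t. AE \<omega> in M. Q t \<omega> = b t"
    by metis
  have all_rat: "AE \<omega> in M. \<forall>r::rat. Q (of_rat r) \<omega> = b (of_rat r)"
    using b by (subst AE_all_countable) blast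
  have "\<exists>\<omega>. \<forall>r::rat. Q (of_rat r) \<omega> = b (of_rat r)"
  proof (rule ccontr)
    assume not: "\<not> ?thesis"
    from all_rat have "AE \<omega> in M. False"
      by (rule eventually_mono) (use not in blast)
    then show False by simp
  qed
  then obtain \<omega>0 where \<omega>0: "\<forall>r::rat. Q (of_rat r) \<omega>0 = b (of_rat r)"
    by (rule exE)
  have le: "\<Sigma> \<omega> \<le> \<Sigma> \<omega>'"
    if "\<forall>r::rat. Q (of_rat r) \<omega> = b (of_rat r)" "\<forall>r::rat. Q (of_rat r) \<omega>' = b (of_rat r)" for \<omega> \<omega>'
  proof (rule ccontr)
    assume "\<not> \<Sigma> \<omega> \<le> \<Sigma> \<omega>'"
    then obtain r :: rat where r: "\<Sigma> \<omega>' < ennreal (of_rat r)" "ennreal (of_rat r) < \<Sigma> \<omega>"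
      using ennreal_rat_dense[of "\<Sigma> \<omega>'" "\<Sigma> \<omega>"] unfolding not_le by blast
    then have "Q (of_rat r) \<omega>'"
      using Q_less that by blast
    then show False
      using Q_le r(1) by (simp add: leD)
  qed
  have "AE \<omega> in M. \<Sigma> \<omega> = \<Sigma> \<omega>0"
    using all_rat by (rule eventually_mono) (intro antisym le \<omega>0)
  then show ?thesis
    unfolding \<Sigma>_def by blast
qed

text \<open>Two almost sure values of the same function agree, so the definite description in
\<^const>\<open>M_c_bar\<close> picks the constant found above.\<close>
lemma AE_Sigma_bar_eq_M_c_bar: "AE \<omega> in M. Sigma_bar (\<lambda>e. X e \<omega>) (\<lambda>e. Y e \<omega>) = M_c_bar M X Y"
proof -
  obtain c where c: "AE \<omega> in M. Sigma_bar (\<lambda>e. X e \<omega>) (\<lambda>e. Y e \<omega>) = c"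
    using Sigma_bar_AE_const by blast
  have "M_c_bar M X Y = c"
    unfolding M_c_bar_def
  proof (rule the_equality)
    show "AE \<omega> in M. Sigma_bar (\<lambda>e. X e \<omega>) (\<lambda>e. Y e \<omega>) = c"
      by (rule c)
  next
    fix c' assume "AE \<omega> in M. Sigma_bar (\<lambda>e. X e \<omega>) (\<lambda>e. Y e \<omega>) = c'"
    with c have "AE \<omega> in M. c' = c"
      by eventually_elim simp
    then show "c' = c" by simp
  qed
  with c show ?thesis by simp
qed

text \<open>A blocking pattern on finitely many edges that has positive probability at each of them has positive
probability as a whole, by independence; the zero-one law turns this into an almost sure lower bound.\<close>
lemma le_M_c_bar:
  assumes J: "finite J" "J \<subseteq> E2" 
    and A: "\<And>e. e \<in> J \<Longrightarrow> A e \<in> sets borel" "\<And>e. e \<in> J \<Longrightarrow> 0 < prob (weight e -` A e \<inter> space M)"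
    and blocked: "\<And>w. (\<And>e. e \<in> J \<Longrightarrow> w e \<in> A e) \<Longrightarrow> \<exists>u v. blocked w t u v"
  shows "ennreal t \<le> M_c_bar M X Y"
proof -
  let ?P = "{\<omega> \<in> space M. \<forall>e\<in>J. weight e \<omega> \<in> A e}"
  have P: "?P \<in> events"
  proof (rule sets.sets_Collect_finite_All[OF _ J(1)])
    fix e assume e: "e \<in> J"
    then have "weight e -` A e \<inter> space M \<in> events"
      using J(2) A(1) by (intro measurable_sets[OF measurable_weight]) auto
    then show "{\<omega> \<in> space M. weight e \<omega> \<in> A e} \<in> events"
      by (simp add: vimage_def Int_def conj_commute)
  qed
  have pos: "0 < prob ?P"
  proof (cases "J = {}")
    case False
    have "?P = (\<Inter>e\<in>J. weight e -` A e \<inter> space M)"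
      using False by auto
    also have "prob \<dots> = (\<Prod>e\<in>J. prob (weight e -` A e \<inter> space M))"
      using False J A(1) by (intro indep_varsD[OF indep_weight])
    also have "\<dots> > 0"
      using A(2) by (intro prod_pos) auto
    finally show ?thesis .
  qed (simp add: prob_space)
  have "AE \<omega> in M. \<exists>u v. blocked (\<lambda>e. weight e \<omega>) t u v"
  proof (rule ccontr)
    assume "\<not> ?thesis"
    then have "AE \<omega> in M. \<not> (\<exists>u v. blocked (\<lambda>e. weight e \<omega>) t u v)"
      using AE_blocked_zero_one by blast
    then have "AE \<omega> in M. \<omega> \<notin> ?P"
    proof (rule eventually_mono)
      fix \<omega> assume not: "\<not> (\<exists>u v. blocked (\<lambda>e. weight e \<omega>) t u v)"
      show "\<omega> \<notin> ?P"
      proof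
        assume "\<omega> \<in> ?P"
        then have "\<exists>u v. blocked (\<lambda>e. weight e \<omega>) t u v"
          by (intro blocked) auto
        with not show False ..
      qed
    qed
    then have "prob ?P = 0"
      using P by (simp add: prob_Collect_eq_0)
    with pos show False by simp
  qed
  with AE_Sigma_bar_eq_M_c_bar have "AE \<omega> in M. ennreal t \<le> M_c_bar M X Y"
  proof eventually_elim
    fix \<omega>
    assume "Sigma_bar (\<lambda>e. X e \<omega>) (\<lambda>e. Y e \<omega>) = M_c_bar M X Y" "\<exists>u v. blocked (\<lambda>e. weight e \<omega>) t u v"
    then show "ennreal t \<le> M_c_bar M X Y"
      using blocked_le_Sigma_bar[of "\<lambda>e. Y e \<omega>" "\<lambda>e. X e \<omega>"] unfolding weight_def by metis
  qed
  then show ?thesis by simp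
qed

section \<open>Finiteness\<close>

lemma prob_flow_eq_0:
  assumes L: "real_distribution L" and no_atom: "\<And>x. atom L x \<Longrightarrow> x = 0"
    and e: "{a, b} \<in> E2" and r: "r \<noteq> 0"
  shows "prob ((\<lambda>\<omega>. flow (\<lambda>e. weight e \<omega>) a b) -` {r} \<inter> space M) = 0"
proof -
  interpret L: real_distribution L by fact
  have "measure L {x} = 0" if "x \<noteq> 0" for x
    using no_atom[of x] that unfolding atom_def zero_less_measure_iff by blast
  then have L0: "measure L {r, - r} = 0"
    using L.finite_measure_Union[of "{r}" "{- r}"] r by (simp add: insert_commute)
  moreover have "uminus -` {r, - r} = {r, - r}"
    by (auto simp: minus_equation_iff)
  ultimately have "prob (weight {a, b} -` {r, - r} \<inter> space M) = 0"
    using prob_weight[OF e, of "{r, - r}"] by simp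
  moreover have "(\<lambda>\<omega>. flow (\<lambda>e. weight e \<omega>) a b) -` {r} \<inter> space M \<subseteq> weight {a, b} -` {r, - r} \<inter> space M"
  proof
    fix \<omega> assume "\<omega> \<in> (\<lambda>\<omega>. flow (\<lambda>e. weight e \<omega>) a b) -` {r} \<inter> space M"
    then show "\<omega> \<in> weight {a, b} -` {r, - r} \<inter> space M"
      using abs_flow[OF e, of "\<lambda>e. weight e \<omega>"] by auto
  qed
  ultimately show ?thesis
    using e by (metis finite_measure_mono measurable_sets[OF measurable_weight] measure_le_0_iff borel_closed
        finite_imp_closed finite.emptyI finite.insertI)
qed

text \<open>The flow along the edge from \<open>a\<close> to \<open>b\<close> is independent of the flow along the rest of the plaquette, and it has
no atom except zero.\<close>
lemma AE_circulation_neq_0: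
  assumes L: "real_distribution L" and no_atom: "\<And>x. atom L x \<Longrightarrow> x = 0"
    and e: "{a, b} \<in> E2"
  shows "AE \<omega> in M. weight {a, b} \<omega> \<noteq> 0 \<longrightarrow> circulation (\<lambda>e. weight e \<omega>) a b \<noteq> 0"
proof -
  define c d where "c = left a b b" and "d = left a b a"
  define J where "J = {{b, c}, {c, d}, {d, a}}"
  have J: "J \<subseteq> E2" "{{a, b}} \<inter> J = {}"
    using plaquette_edges[OF e] e unfolding J_def c_def d_def
    by (auto simp: doubleton_eq_iff left_def edge_iff prod_eq_iff)
  define U where "U f = flow f a b" for f
  define R where "R f = flow f b c + flow f c d + flow f d a" for f
  have "indep_var (PiM {{a, b}} (\<lambda>_. borel)) (\<lambda>\<omega>. restrict (\<lambda>e. weight e \<omega>) {{a, b}})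
      (PiM J (\<lambda>_. borel)) (\<lambda>\<omega>. restrict (\<lambda>e. weight e \<omega>) J)"
    using J e by (intro indep_var_restrict[OF indep_weight]) auto
  moreover have "U \<in> borel_measurable (PiM {{a, b}} (\<lambda>_. borel))"
    unfolding U_def flow_def by measurable
  moreover have "R \<in> borel_measurable (PiM J (\<lambda>_. borel))"
    unfolding R_def flow_def J_def by measurable
  ultimately have "indep_var borel (U \<circ> (\<lambda>\<omega>. restrict (\<lambda>e. weight e \<omega>) {{a, b}}))
      borel (R \<circ> (\<lambda>\<omega>. restrict (\<lambda>e. weight e \<omega>) J))"
    by (rule indep_var_compose)
  then have "indep_var borel (\<lambda>\<omega>. U (\<lambda>e. weight e \<omega>)) borel (\<lambda>\<omega>. R (\<lambda>e. weight e \<omega>))"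
    by (simp add: comp_def U_def R_def flow_def J_def)
  then have "AE \<omega> in M. U (\<lambda>e. weight e \<omega>) \<noteq> 0 \<longrightarrow> U (\<lambda>e. weight e \<omega>) + R (\<lambda>e. weight e \<omega>) \<noteq> 0"
    by (rule AE_add_indep_neq_0) (unfold U_def, rule prob_flow_eq_0[OF L no_atom e])
  then show ?thesis
  proof (rule eventually_mono)
    fix \<omega>
    assume "U (\<lambda>e. weight e \<omega>) \<noteq> 0 \<longrightarrow> U (\<lambda>e. weight e \<omega>) + R (\<lambda>e. weight e \<omega>) \<noteq> 0"
    then show "weight {a, b} \<omega> \<noteq> 0 \<longrightarrow> circulation (\<lambda>e. weight e \<omega>) a b \<noteq> 0"
      using abs_flow[OF e, of "\<lambda>e. weight e \<omega>"]
      by (auto simp: U_def R_def circulation_def c_def d_def add.assoc)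
  qed
qed

lemma AE_weight_bounded:
  assumes L: "real_distribution L" and K: "\<And>x. x \<in> law_support L \<Longrightarrow> \<bar>x\<bar> \<le> K"
    and e: "e \<in> E2"
  shows "AE \<omega> in M. \<bar>weight e \<omega>\<bar> \<le> K"
proof -
  interpret L: real_distribution L by fact
  define A where "A = {x :: real. K < \<bar>x\<bar>}"
  have "open A"
    unfolding A_def by (intro open_Collect_less continuous_intros)
  then have A: "A \<in> sets borel" by simp
  have "open (- law_support L)"
    by (auto simp: law_support_compl)
  then have "measure L A \<le> measure L (- law_support L)"
    using K by (intro L.finite_measure_mono) (force simp: A_def)+
  then have "measure L A = 0"
    using measure_law_support_compl[OF L] by (simp add: measure_le_0_iff)
  moreover have "uminus -` A = A"
    by (auto simp: A_def)
  ultimately have "prob (weight e -` A \<inter> space M) = 0"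
    using prob_weight[OF e A] by simp
  moreover have "weight e -` A \<inter> space M \<in> events"
    using A measurable_weight[OF e] by (rule measurable_sets[rotated])
  ultimately show ?thesis
    by (intro AE_I[of _ _ "weight e -` A \<inter> space M"]) (auto simp: A_def emeasure_eq_measure)
qed

lemma M_c_bar_le:
  assumes L: "real_distribution L" and K: "\<And>x. x \<in> law_support L \<Longrightarrow> \<bar>x\<bar> \<le> K"
    and no_atom: "\<And>x. atom L x \<Longrightarrow> x = 0"
  shows "M_c_bar M X Y \<le> ennreal (7 * K)"
proof -
  have bounded: "AE \<omega> in M. \<forall>e\<in>E2. \<bar>weight e \<omega>\<bar> \<le> K"
    using countable_E2 AE_weight_bounded[OF L K] by (simp add: AE_ball_countable)
  have circ: "AE \<omega> in M. \<forall>a b. {a, b} \<in> E2 \<longrightarrow> weight {a, b} \<omega> \<noteq> 0 \<longrightarrow>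
      circulation (\<lambda>e. weight e \<omega>) a b \<noteq> 0"
    unfolding AE_all_countable using AE_circulation_neq_0[OF L no_atom] by auto
  from bounded circ AE_Sigma_bar_eq_M_c_bar
  have "AE \<omega> in M. M_c_bar M X Y \<le> ennreal (7 * K)"
  proof eventually_elim
    fix \<omega>
    assume "\<forall>e\<in>E2. \<bar>weight e \<omega>\<bar> \<le> K"
      "\<forall>a b. {a, b} \<in> E2 \<longrightarrow> weight {a, b} \<omega> \<noteq> 0 \<longrightarrow> circulation (\<lambda>e. weight e \<omega>) a b \<noteq> 0"
    then have "Sigma_bar (\<lambda>e. X e \<omega>) (\<lambda>e. Y e \<omega>) \<le> ennreal (7 * K)"
      unfolding weight_def by (intro Sigma_bar_le) blast+
    moreover assume "Sigma_bar (\<lambda>e. X e \<omega>) (\<lambda>e. Y e \<omega>) = M_c_bar M X Y"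
    ultimately show "M_c_bar M X Y \<le> ennreal (7 * K)" by simp
  qed
  then show ?thesis by simp
qed

section \<open>Infiniteness\<close>

lemma prob_weight_pos:
  assumes p: "0 < p_o" "p_o < 1" "0 < p_v" "p_v < 1"
    and e: "e \<in> E2" and A: "A \<in> sets borel" and pos: "0 < measure L A \<or> 0 < measure L (uminus -` A)"
  shows "0 < prob (weight e -` A \<inter> space M)"
proof -
  have "0 < sign_prob e" "sign_prob e < 1"
    using p by (auto simp: sign_prob_def)
  then show ?thesis
    unfolding prob_weight[OF e A] using pos
    by (auto intro: add_pos_nonneg add_nonneg_pos)
qed

lemma le_M_c_bar_if_unbounded_support:
  assumes p: "0 < p_o" "p_o < 1" "0 < p_v" "p_v < 1"
    and L: "real_distribution L" and unbounded: "\<not> bounded (law_support L)"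
  shows "ennreal t \<le> M_c_bar M X Y"
proof -
  interpret L: real_distribution L by fact
  obtain x where x: "x \<in> law_support L" "t < \<bar>x\<bar>"
    using unbounded unfolding bounded_iff by (metis not_le real_norm_def)
  define A where "A = {x. t \<le> \<bar>x\<bar>}"
  have open_gt: "open {x. t < \<bar>x\<bar>}"
    by (intro open_Collect_less continuous_intros)
  have "closed A"
    unfolding A_def by (intro closed_Collect_le continuous_intros)
  then have A: "A \<in> sets borel" by simp
  have "0 < measure L {x. t < \<bar>x\<bar>}"
    using x open_gt by (auto simp: law_support_def)
  also have "\<dots> \<le> measure L A"
    using A by (intro L.finite_measure_mono) (auto simp: A_def)
  finally have "0 < measure L A" .
  show ?thesis
  proof (rule le_M_c_bar[OF finite_ball_edges ball_edges_subset, where A = "\<lambda>_. A"])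
    fix e assume "e \<in> ball_edges 1"
    then have "e \<in> E2"
      using ball_edges_subset by blast
    then show "0 < prob (weight e -` A \<inter> space M)"
      using A \<open>0 < measure L A\<close> by (intro prob_weight_pos[OF p]) auto
  next
    fix w :: "edge \<Rightarrow> real" assume "\<And>e. e \<in> ball_edges 1 \<Longrightarrow> w e \<in> A"
    then have "blocked w t (0, 0) (1, 0)"
      by (intro blocked_large_edges) (simp add: A_def)
    then show "\<exists>u v. blocked w t u v"
      by blast
  qed (rule A)
qed

lemma le_M_c_bar_if_atom:
  assumes p: "0 < p_o" "p_o < 1" "0 < p_v" "p_v < 1"
    and x: "atom L x"
  shows "ennreal (real n * \<bar>x\<bar>) \<le> M_c_bar M X Y"
proof (rule le_M_c_bar[OF finite_ball_edges ball_edges_subset, where A = "\<lambda>e. {x * outward e}"])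
  fix e assume "e \<in> ball_edges (int n)"
  then have e: "e \<in> E2"
    using ball_edges_subset by blast
  then obtain a b where "e = {a, b}" "{a, b} \<in> E2"
    by (rule E2_cases)
  then have "outward e \<in> {-1, 1}"
    using outward(2) by blast
  moreover have "uminus -` {- x} = {x}"
    by auto
  ultimately have "0 < measure L {x * outward e} \<or> 0 < measure L (uminus -` {x * outward e})"
    using x by (auto simp: atom_def)
  then show "0 < prob (weight e -` {x * outward e} \<inter> space M)"
    by (intro prob_weight_pos[OF p e]) auto
next
  fix w assume "\<And>e. e \<in> ball_edges (int n) \<Longrightarrow> w e \<in> {x * outward e}"
  then show "\<exists>u v. blocked w (real n * \<bar>x\<bar>) u v"
    using blocked_outward[of n w x] by blast
qed auto

end

theorem theorem3:
  fixes M :: "'a measure"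
    and X Y :: "edge \<Rightarrow> 'a \<Rightarrow> real"
    and p_o p_v :: real
    and L :: "real measure"
  assumes "0 < p_o" "p_o < 1" "0 < p_v" "p_v < 1"
    and "real_distribution L"
    and "L \<noteq> return borel 0"
    and "random_environment M X Y p_o p_v L"
  shows "M_c_bar M X Y < \<infinity> \<longleftrightarrow> bounded (law_support L) \<and> (\<forall>x. atom L x \<longrightarrow> x = 0)"
proof -
  interpret random_environment M X Y p_o p_v L by fact
  show ?thesis
  proof
    assume "M_c_bar M X Y < \<infinity>"
    then obtain m where m: "0 \<le> m" "M_c_bar M X Y = ennreal m"
      by (cases "M_c_bar M X Y") auto
    have "bounded (law_support L)"
    proof (rule ccontr)
      assume "\<not> bounded (law_support L)"
      then have "ennreal (m + 1) \<le> ennreal m"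
        using le_M_c_bar_if_unbounded_support[OF assms(1-5)] m(2) by metis
      then show False
        using m(1) by (simp add: ennreal_le_iff)
    qed
    moreover have "x = 0" if "atom L x" for x
    proof (rule ccontr)
      assume "x \<noteq> 0"
      then obtain n where "m < real n * \<bar>x\<bar>"
        using reals_Archimedean3[of "\<bar>x\<bar>"] by auto
      moreover have "ennreal (real n * \<bar>x\<bar>) \<le> ennreal m"
        using le_M_c_bar_if_atom[OF assms(1-4) that] m(2) by metis
      ultimately show False
        using m(1) by (simp add: ennreal_le_iff)
    qed
    ultimately show "bounded (law_support L) \<and> (\<forall>x. atom L x \<longrightarrow> x = 0)"
      by blast
  next
    assume finite: "bounded (law_support L) \<and> (\<forall>x. atom L x \<longrightarrow> x = 0)"
    then obtain K where "\<And>x. x \<in> law_support L \<Longrightarrow> \<bar>x\<bar> \<le> K"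
      unfolding bounded_iff real_norm_def by blast
    then have "M_c_bar M X Y \<le> ennreal (7 * K)"
      using finite by (intro M_c_bar_le[OF assms(5)]) auto
    also have "\<dots> < \<infinity>"
      by simp
    finally show "M_c_bar M X Y < \<infinity>" .
  qed
qed

end
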